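(* Let $G$ be a complex reductive group acting on a finite dimensional complex vector space $V$. Then $(G,V)$ is skew multiplicity-free if and only if the invariant algebra $Cl(V\oplus V^* )^G$ is commutative.
   Context: $(G,V)$ is skew multiplicity-free (SMF) if the exterior algebra $\bigwedge V$ is a multiplicity-free $G$-module, i.e. $\dim\mathrm{Hom}_G(\Gamma,\bigwedge V)\le1$ for all irreducible representations $\Gamma$ of $G$. $Cl(V\oplus V^* )$ denotes the Clifford algebra of $V\oplus V^*$ equipped with the canonical symmetric pairing $\langle(v,\lambda),(w,\mu)\rangle:=\lambda(w)+\mu(v)$ for $v,w\in V$, $\lambda,\mu\in V^*$. The action of $G$ on $V$ induces an action on $V\oplus V^*$ preserving this pairing and hence an action on $Cl(V\oplus V^* )$ by algebra automorphisms; $Cl(V\oplus V^* )^G$ is the subalgebra of invariants. *)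

theory Defs
  imports
    "HOL-Analysis.Analysis"
    "HOL-Library.Function_Algebras"
    "HOL-Library.Poly_Mapping"
begin

section \<open>Complex vector spaces\<close>

class complex_vector = ab_group_add +
  fixes scaleC :: "complex \<Rightarrow> 'a \<Rightarrow> 'a" (infixr \<open>*\<^sub>C\<close> 75)
  assumes scaleC_add_right: "a *\<^sub>C (x + y) = a *\<^sub>C x + a *\<^sub>C y"
    and scaleC_add_left: "(a + b) *\<^sub>C x = a *\<^sub>C x + b *\<^sub>C x"
    and scaleC_scaleC: "a *\<^sub>C b *\<^sub>C x = (a * b) *\<^sub>C x"
    and scaleC_one: "1 *\<^sub>C x = x"

interpretation complex_vector: vector_space "scaleC :: complex \<Rightarrow> 'a \<Rightarrow> 'a::complex_vector"
  by unfold_locales (rule scaleC_add_right scaleC_add_left scaleC_scaleC scaleC_one)+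

instantiation complex :: complex_vector
begin

definition scaleC_complex :: "complex \<Rightarrow> complex \<Rightarrow> complex"
  where "scaleC_complex a x = a * x"

instance
  by standard (simp_all add: scaleC_complex_def algebra_simps)

end

instantiation prod :: (complex_vector, complex_vector) complex_vector
begin

definition scaleC_prod :: "complex \<Rightarrow> 'a \<times> 'b \<Rightarrow> 'a \<times> 'b"
  where "scaleC_prod c x = (c *\<^sub>C fst x, c *\<^sub>C snd x)"

instance
  by standard (simp_all add: scaleC_prod_def prod_eq_iff
      scaleC_add_right scaleC_add_left scaleC_scaleC scaleC_one)

end

instantiation "fun" :: (type, complex_vector) complex_vector
begin

definition scaleC_fun :: "complex \<Rightarrow> ('a \<Rightarrow> 'b) \<Rightarrow> 'a \<Rightarrow> 'b"
  where "scaleC_fun c f = (\<lambda>x. c *\<^sub>C f x)"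

instance
  by standard (simp_all add: scaleC_fun_def fun_eq_iff
      scaleC_add_right scaleC_add_left scaleC_scaleC scaleC_one)

end

abbreviation complex_linear :: "('a::complex_vector \<Rightarrow> 'b::complex_vector) \<Rightarrow> bool"
  where "complex_linear \<equiv> Vector_Spaces.linear scaleC scaleC"

lemma complex_linear_iff:
  "complex_linear f \<longleftrightarrow> (\<forall>x y. f (x + y) = f x + f y) \<and> (\<forall>c x. f (c *\<^sub>C x) = c *\<^sub>C f x)"
  by (auto simp: Vector_Spaces.linear_iff complex_vector.vector_space_axioms)

typedef (overloaded) 'v dual = "{f :: 'v::complex_vector \<Rightarrow> complex. complex_linear f}"
  morphisms dual_apply Abs_dual
  by (rule exI[of _ "\<lambda>_. 0"]) (simp add: complex_linear_iff)

setup_lifting type_definition_dual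

instantiation dual :: (complex_vector) complex_vector
begin

lift_definition zero_dual :: "'a dual" is "\<lambda>_. 0"
  by (simp add: complex_linear_iff)

lift_definition plus_dual :: "'a dual \<Rightarrow> 'a dual \<Rightarrow> 'a dual" is "\<lambda>f g x. f x + g x"
  by (simp add: complex_linear_iff scaleC_add_right)

lift_definition minus_dual :: "'a dual \<Rightarrow> 'a dual \<Rightarrow> 'a dual" is "\<lambda>f g x. f x - g x"
  by (simp add: complex_linear_iff complex_vector.scale_right_diff_distrib)

lift_definition uminus_dual :: "'a dual \<Rightarrow> 'a dual" is "\<lambda>f x. - f x"
  by (simp add: complex_linear_iff)

lift_definition scaleC_dual :: "complex \<Rightarrow> 'a dual \<Rightarrow> 'a dual" is "\<lambda>c f x. c *\<^sub>C f x"
  by (simp add: complex_linear_iff scaleC_add_right scaleC_scaleC mult.commute)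

instance
  by standard (transfer; simp add: fun_eq_iff
      scaleC_add_right scaleC_add_left scaleC_scaleC scaleC_one)+

end

section \<open>Algebras given by generators and relations\<close>

datatype 'a free_word = Word (letters: "'a list")

instantiation free_word :: (type) monoid_add
begin

definition zero_free_word :: "'a free_word"
  where "zero_free_word = Word []"

definition plus_free_word :: "'a free_word \<Rightarrow> 'a free_word \<Rightarrow> 'a free_word"
  where "plus_free_word u v = Word (letters u @ letters v)"

instance
  by standard (simp_all add: zero_free_word_def plus_free_word_def)

end

text \<open>
  Poly-mappings multiply by convolution over the (additively written) free monoid of words,
  so the following is the free associative unital algebra over the complex numbers on the
  \<^emph>\<open>set\<close> of generators \<open>'a\<close>.
\<close>

type_synonym 'a free_algebra = "'a free_word \<Rightarrow>\<^sub>0 complex"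

definition free_gen :: "'a \<Rightarrow> 'a free_algebra"
  where "free_gen v = Poly_Mapping.single (Word [v]) 1"

definition free_const :: "complex \<Rightarrow> 'a free_algebra"
  where "free_const c = Poly_Mapping.single 0 c"

text \<open>The algebra homomorphism that extends a map of generators.\<close>

definition free_map :: "('a \<Rightarrow> 'b) \<Rightarrow> 'a free_algebra \<Rightarrow> 'b free_algebra"
  where "free_map h p =
    (\<Sum>w\<in>Poly_Mapping.keys p. Poly_Mapping.single (map_free_word h w) (Poly_Mapping.lookup p w))"

inductive_set two_sided_ideal :: "'a::ring_1 set \<Rightarrow> 'a set" for S :: "'a set"
  where
    zero: "0 \<in> two_sided_ideal S"
  | gen: "s \<in> S \<Longrightarrow> a * s * b \<in> two_sided_ideal S"
  | add: "x \<in> two_sided_ideal S \<Longrightarrow> y \<in> two_sided_ideal S \<Longrightarrow> x + y \<in> two_sided_ideal S"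

lemma two_sided_ideal_mult_left: "x \<in> two_sided_ideal S \<Longrightarrow> c * x \<in> two_sided_ideal S"
proof (induction rule: two_sided_ideal.induct)
  case (gen s a b)
  then show ?case
    using two_sided_ideal.gen[of s S "c * a" b] by (simp add: mult.assoc)
qed (simp_all add: two_sided_ideal.zero two_sided_ideal.add distrib_left)

lemma two_sided_ideal_mult_right: "x \<in> two_sided_ideal S \<Longrightarrow> x * c \<in> two_sided_ideal S"
proof (induction rule: two_sided_ideal.induct)
  case (gen s a b)
  then show ?case
    using two_sided_ideal.gen[of s S a "b * c"] by (simp add: mult.assoc)
qed (simp_all add: two_sided_ideal.zero two_sided_ideal.add distrib_right)

lemma two_sided_ideal_uminus: "x \<in> two_sided_ideal S \<Longrightarrow> - x \<in> two_sided_ideal S"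
  using two_sided_ideal_mult_left[of x S "- 1"] by simp

lemma two_sided_ideal_diff:
  "x \<in> two_sided_ideal S \<Longrightarrow> y \<in> two_sided_ideal S \<Longrightarrow> x - y \<in> two_sided_ideal S"
  using two_sided_ideal.add[of x S "- y"] two_sided_ideal_uminus[of y S] by simp

definition cong_modulo :: "'a::ring_1 set \<Rightarrow> 'a \<Rightarrow> 'a \<Rightarrow> bool"
  where "cong_modulo S x y \<longleftrightarrow> x - y \<in> two_sided_ideal S"

lemma equivp_cong_modulo: "equivp (cong_modulo S)"
proof (rule equivpI)
  show "reflp (cong_modulo S)"
    by (simp add: reflp_def cong_modulo_def two_sided_ideal.zero)
  show "symp (cong_modulo S)"
    using two_sided_ideal_uminus by (fastforce simp: symp_def cong_modulo_def)
  show "transp (cong_modulo S)"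
    using two_sided_ideal.add by (fastforce simp: transp_def cong_modulo_def)
qed

lemma cong_modulo_refl: "cong_modulo S x x"
  by (simp add: cong_modulo_def two_sided_ideal.zero)

lemma cong_modulo_add:
  "cong_modulo S a b \<Longrightarrow> cong_modulo S c d \<Longrightarrow> cong_modulo S (a + c) (b + d)"
  unfolding cong_modulo_def add_diff_add by (rule two_sided_ideal.add)

lemma cong_modulo_uminus: "cong_modulo S a b \<Longrightarrow> cong_modulo S (- a) (- b)"
  unfolding cong_modulo_def using two_sided_ideal_uminus by fastforce

lemma cong_modulo_diff:
  "cong_modulo S a b \<Longrightarrow> cong_modulo S c d \<Longrightarrow> cong_modulo S (a - c) (b - d)"
  using cong_modulo_add[OF _ cong_modulo_uminus, of S a b c d] by simp

lemma cong_modulo_mult: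
  assumes "cong_modulo S a b" "cong_modulo S c d"
  shows "cong_modulo S (a * c) (b * d)"
proof -
  have "a * c - b * d = (a - b) * c + b * (c - d)"
    by (simp add: algebra_simps)
  then show ?thesis
    using assms unfolding cong_modulo_def
    by (simp add: two_sided_ideal.add two_sided_ideal_mult_left two_sided_ideal_mult_right)
qed

lemma free_const_add: "free_const (a + b) = free_const a + free_const b"
  by (simp add: free_const_def single_add)

lemma free_const_mult: "free_const (a * b) = free_const a * free_const b"
  by (simp add: free_const_def mult_single)

lemma free_const_one: "free_const 1 = 1"
  by (simp add: free_const_def)

text \<open>Modulo these relations the free algebra becomes the tensor algebra of \<open>'v\<close>.\<close>

definition tensor_relations :: "'v::complex_vector free_algebra set"
  where "tensor_relations =
      {free_gen (v + w) - (free_gen v + free_gen w) | v w. True}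
    \<union> {free_gen (c *\<^sub>C v) - free_const c * free_gen v | c v. True}"

definition exterior_relations :: "'v::complex_vector free_algebra set"
  where "exterior_relations = tensor_relations \<union> {free_gen v * free_gen v | v. True}"

text \<open>
  The Clifford relation is normalised as \<open>xy + yx = \<langle>x, y\<rangle>\<close>.  The other common normalisation,
  \<open>xy + yx = 2\<langle>x, y\<rangle>\<close>, gives an equivariantly isomorphic algebra, as \<open>x\<close> can be rescaled by a
  square root of 2.
\<close>

definition clifford_relations ::
    "('u::complex_vector \<Rightarrow> 'u \<Rightarrow> complex) \<Rightarrow> 'u free_algebra set"
  where "clifford_relations \<beta> = tensor_relations
    \<union> {free_gen x * free_gen y + free_gen y * free_gen x - free_const (\<beta> x y) | x y. True}"

section \<open>The exterior algebra of V\<close>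

quotient_type (overloaded) 'v exterior =
    "'v::complex_vector free_algebra" / "cong_modulo exterior_relations"
  by (rule equivp_cong_modulo)

instantiation exterior :: (complex_vector) complex_vector
begin

lift_definition zero_exterior :: "'a exterior" is 0 .

lift_definition plus_exterior :: "'a exterior \<Rightarrow> 'a exterior \<Rightarrow> 'a exterior" is "(+)"
  by (rule cong_modulo_add)

lift_definition minus_exterior :: "'a exterior \<Rightarrow> 'a exterior \<Rightarrow> 'a exterior" is "(-)"
  by (rule cong_modulo_diff)

lift_definition uminus_exterior :: "'a exterior \<Rightarrow> 'a exterior" is uminus
  by (rule cong_modulo_uminus)

lift_definition scaleC_exterior :: "complex \<Rightarrow> 'a exterior \<Rightarrow> 'a exterior"
  is "\<lambda>c x. free_const c * x"
  by (simp add: cong_modulo_mult cong_modulo_refl)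

instance
  by standard (transfer; simp add: algebra_simps
      free_const_add free_const_mult free_const_one cong_modulo_refl)+

end

instantiation exterior :: (complex_vector) "{ring, monoid_mult}"
begin

lift_definition one_exterior :: "'a exterior" is 1 .

lift_definition times_exterior :: "'a exterior \<Rightarrow> 'a exterior \<Rightarrow> 'a exterior" is "(*)"
  by (rule cong_modulo_mult)

instance
  by standard (transfer; simp add: algebra_simps cong_modulo_refl)+

end

text \<open>
  The algebra endomorphism of the exterior algebra induced by a linear map \<open>h\<close>: since \<open>h\<close>
  respects the relations, the choice of representative does not matter.
\<close>

definition exterior_map ::
    "('v::complex_vector \<Rightarrow> 'v) \<Rightarrow> 'v exterior \<Rightarrow> 'v exterior"
  where "exterior_map h x = abs_exterior (free_map h (rep_exterior x))"

section \<open>The Clifford algebra of V + V*\<close>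

definition canonical_pairing ::
    "'v::complex_vector \<times> 'v dual \<Rightarrow> 'v \<times> 'v dual \<Rightarrow> complex"
  where "canonical_pairing x y = dual_apply (snd x) (fst y) + dual_apply (snd y) (fst x)"

text \<open>\<open>'v clifford\<close> is the Clifford algebra of \<open>'v \<times> 'v dual\<close>, not of \<open>'v\<close>.\<close>

quotient_type (overloaded) 'v clifford =
    "('v::complex_vector \<times> 'v dual) free_algebra" /
    "cong_modulo (clifford_relations canonical_pairing)"
  by (rule equivp_cong_modulo)

instantiation clifford :: (complex_vector) complex_vector
begin

lift_definition zero_clifford :: "'a clifford" is 0 .

lift_definition plus_clifford :: "'a clifford \<Rightarrow> 'a clifford \<Rightarrow> 'a clifford" is "(+)"
  by (rule cong_modulo_add)

lift_definition minus_clifford :: "'a clifford \<Rightarrow> 'a clifford \<Rightarrow> 'a clifford" is "(-)"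
  by (rule cong_modulo_diff)

lift_definition uminus_clifford :: "'a clifford \<Rightarrow> 'a clifford" is uminus
  by (rule cong_modulo_uminus)

lift_definition scaleC_clifford :: "complex \<Rightarrow> 'a clifford \<Rightarrow> 'a clifford"
  is "\<lambda>c x. free_const c * x"
  by (simp add: cong_modulo_mult cong_modulo_refl)

instance
  by standard (transfer; simp add: algebra_simps
      free_const_add free_const_mult free_const_one cong_modulo_refl)+

end

instantiation clifford :: (complex_vector) "{ring, monoid_mult}"
begin

lift_definition one_clifford :: "'a clifford" is 1 .

lift_definition times_clifford :: "'a clifford \<Rightarrow> 'a clifford \<Rightarrow> 'a clifford" is "(*)"
  by (rule cong_modulo_mult)

instance
  by standard (transfer; simp add: algebra_simps cong_modulo_refl)+

end

text \<open>As for \<open>exterior_map\<close>; here \<open>h\<close> has to be a linear isometry of the pairing.\<close>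

definition clifford_map ::
    "('v::complex_vector \<times> 'v dual \<Rightarrow> 'v \<times> 'v dual) \<Rightarrow> 'v clifford \<Rightarrow> 'v clifford"
  where "clifford_map h x = abs_clifford (free_map h (rep_clifford x))"

section \<open>Linear algebraic groups and their regular representations\<close>

inductive_set polynomial_functions :: "(complex^'n^'n \<Rightarrow> complex) set"
  where
    const: "(\<lambda>_. c) \<in> polynomial_functions"
  | entry: "(\<lambda>A. A $ i $ j) \<in> polynomial_functions"
  | add: "f \<in> polynomial_functions \<Longrightarrow> g \<in> polynomial_functions \<Longrightarrow>
      (\<lambda>A. f A + g A) \<in> polynomial_functions"
  | mult: "f \<in> polynomial_functions \<Longrightarrow> g \<in> polynomial_functions \<Longrightarrow>
      (\<lambda>A. f A * g A) \<in> polynomial_functions"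

text \<open>Zariski-closed subgroups of the general linear group.\<close>

definition linear_algebraic_group :: "(complex^'n^'n) set \<Rightarrow> bool"
  where "linear_algebraic_group G \<longleftrightarrow>
    (\<exists>P \<subseteq> polynomial_functions. G = {A. invertible A \<and> (\<forall>f\<in>P. f A = 0)}) \<and>
    mat 1 \<in> G \<and>
    (\<forall>A\<in>G. \<forall>B\<in>G. A ** B \<in> G) \<and>
    (\<forall>A\<in>G. matrix_inv A \<in> G)"

text \<open>Restrictions to \<open>G\<close> of polynomials in the matrix entries and the inverse of the determinant.\<close>

definition regular_on :: "(complex^'n^'n) set \<Rightarrow> (complex^'n^'n \<Rightarrow> complex) \<Rightarrow> bool"
  where "regular_on G f \<longleftrightarrow>
    (\<exists>p\<in>polynomial_functions. \<exists>k::nat. \<forall>A\<in>G. f A = p A / det A ^ k)"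

text \<open>
  A finite-dimensional regular representation of \<open>G\<close> on the subspace \<open>W\<close> of an ambient complex
  vector space.  Only the values \<open>\<sigma> g w\<close> for \<open>g \<in> G\<close> and \<open>w \<in> W\<close> matter.  Every linear functional
  on \<open>W\<close> extends to the ambient space, so the last clause is about all matrix coefficients.
\<close>

definition regular_representation ::
    "(complex^'n^'n) set \<Rightarrow> 'w::complex_vector set \<Rightarrow> (complex^'n^'n \<Rightarrow> 'w \<Rightarrow> 'w) \<Rightarrow> bool"
  where "regular_representation G W \<sigma> \<longleftrightarrow>
    (\<exists>B. finite B \<and> W = complex_vector.span B) \<and>
    (\<forall>g\<in>G. \<forall>x\<in>W. \<sigma> g x \<in> W) \<and>
    (\<forall>g\<in>G. \<forall>x\<in>W. \<forall>y\<in>W. \<sigma> g (x + y) = \<sigma> g x + \<sigma> g y) \<and>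
    (\<forall>g\<in>G. \<forall>c. \<forall>x\<in>W. \<sigma> g (c *\<^sub>C x) = c *\<^sub>C \<sigma> g x) \<and>
    (\<forall>x\<in>W. \<sigma> (mat 1) x = x) \<and>
    (\<forall>g\<in>G. \<forall>h\<in>G. \<forall>x\<in>W. \<sigma> (g ** h) x = \<sigma> g (\<sigma> h x)) \<and>
    (\<forall>\<phi>. complex_linear \<phi> \<longrightarrow> (\<forall>x\<in>W. regular_on G (\<lambda>g. \<phi> (\<sigma> g x))))"

definition invariant_subspace ::
    "(complex^'n^'n) set \<Rightarrow> (complex^'n^'n \<Rightarrow> 'w::complex_vector \<Rightarrow> 'w) \<Rightarrow> 'w set \<Rightarrow> bool"
  where "invariant_subspace G \<sigma> U \<longleftrightarrow>
    complex_vector.subspace U \<and> (\<forall>g\<in>G. \<forall>x\<in>U. \<sigma> g x \<in> U)"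

definition irreducible_representation ::
    "(complex^'n^'n) set \<Rightarrow> 'w::complex_vector set \<Rightarrow> (complex^'n^'n \<Rightarrow> 'w \<Rightarrow> 'w) \<Rightarrow> bool"
  where "irreducible_representation G W \<sigma> \<longleftrightarrow>
    regular_representation G W \<sigma> \<and> W \<noteq> {0} \<and>
    (\<forall>U\<subseteq>W. invariant_subspace G \<sigma> U \<longrightarrow> U = {0} \<or> U = W)"

definition completely_reducible ::
    "(complex^'n^'n) set \<Rightarrow> 'w::complex_vector set \<Rightarrow> (complex^'n^'n \<Rightarrow> 'w \<Rightarrow> 'w) \<Rightarrow> bool"
  where "completely_reducible G W \<sigma> \<longleftrightarrow>
    (\<forall>U\<subseteq>W. invariant_subspace G \<sigma> U \<longrightarrow>
      (\<exists>U'\<subseteq>W. invariant_subspace G \<sigma> U' \<and> U \<inter> U' = {0} \<and> {x + y | x y. x \<in> U \<and> y \<in> U'} = W))"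

text \<open>
  Reductive in the sense of Goodman and Wallach, ``Symmetry, Representations, and Invariants'':
  a linear algebraic group all of whose regular representations are completely reducible.
  The group need not be connected.  Up to isomorphism every finite-dimensional complex vector
  space is a subspace of \<open>nat \<Rightarrow> complex\<close>, so quantifying over representations on such
  subspaces reaches all representations, of every dimension.
\<close>

definition reductive_group :: "(complex^'n^'n) set \<Rightarrow> bool"
  where "reductive_group G \<longleftrightarrow> linear_algebraic_group G \<and>
    (\<forall>(W :: (nat \<Rightarrow> complex) set) \<sigma>. regular_representation G W \<sigma> \<longrightarrow> completely_reducible G W \<sigma>)"

section \<open>Skew multiplicity-free representations\<close>

text \<open>
  The equivariant linear maps from \<open>W\<close> to the whole type \<open>'u\<close>, extended by zero outside \<open>W\<close> so
  that each map on \<open>W\<close> is counted once.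
\<close>

definition Hom_G ::
    "(complex^'n^'n) set \<Rightarrow> 'w::complex_vector set \<Rightarrow> (complex^'n^'n \<Rightarrow> 'w \<Rightarrow> 'w) \<Rightarrow>
     (complex^'n^'n \<Rightarrow> 'u::complex_vector \<Rightarrow> 'u) \<Rightarrow> ('w \<Rightarrow> 'u) set"
  where "Hom_G G W \<sigma> \<tau> = {f.
    (\<forall>x\<in>W. \<forall>y\<in>W. f (x + y) = f x + f y) \<and>
    (\<forall>c. \<forall>x\<in>W. f (c *\<^sub>C x) = c *\<^sub>C f x) \<and>
    (\<forall>g\<in>G. \<forall>x\<in>W. f (\<sigma> g x) = \<tau> g (f x)) \<and>
    (\<forall>x. x \<notin> W \<longrightarrow> f x = 0)}"

text \<open>
  \<open>dim\<close> is 0 on infinite-dimensional spaces, but for finite-dimensional \<open>'v\<close> all the spaces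
  \<open>Hom_G\<close> below are finite-dimensional.
\<close>

definition skew_multiplicity_free ::
    "(complex^'n^'n) set \<Rightarrow> (complex^'n^'n \<Rightarrow> 'v::complex_vector \<Rightarrow> 'v) \<Rightarrow> bool"
  where "skew_multiplicity_free G \<rho> \<longleftrightarrow>
    (\<forall>(W :: (nat \<Rightarrow> complex) set) \<sigma>. irreducible_representation G W \<sigma> \<longrightarrow>
      complex_vector.dim (Hom_G G W \<sigma> (\<lambda>g. exterior_map (\<rho> g))) \<le> 1)"

section \<open>Invariants of the Clifford algebra\<close>

definition dual_action ::
    "(complex^'n^'n \<Rightarrow> 'v::complex_vector \<Rightarrow> 'v) \<Rightarrow> complex^'n^'n \<Rightarrow> 'v dual \<Rightarrow> 'v dual"
  where "dual_action \<rho> g \<mu> = Abs_dual (\<lambda>v. dual_apply \<mu> (\<rho> (matrix_inv g) v))"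

definition double_action ::
    "(complex^'n^'n \<Rightarrow> 'v::complex_vector \<Rightarrow> 'v) \<Rightarrow>
     complex^'n^'n \<Rightarrow> 'v \<times> 'v dual \<Rightarrow> 'v \<times> 'v dual"
  where "double_action \<rho> g x = (\<rho> g (fst x), dual_action \<rho> g (snd x))"

definition clifford_invariants ::
    "(complex^'n^'n) set \<Rightarrow> (complex^'n^'n \<Rightarrow> 'v::complex_vector \<Rightarrow> 'v) \<Rightarrow> 'v clifford set"
  where "clifford_invariants G \<rho> = {x. \<forall>g\<in>G. clifford_map (double_action \<rho> g) x = x}"

end

theory Submission
  imports Defs "HOL-Computational_Algebra.Fundamental_Theorem_Algebra"
begin

text \<open>
  The Clifford algebra of \<open>V \<oplus> V\<^sup>*\<close> acts on the exterior algebra of \<open>V\<close>: vectors multiply from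
  the left and functionals contract.  This spin representation identifies the Clifford algebra
  with the algebra of all linear endomorphisms of the exterior algebra
  (\<open>spin_injective\<close>, \<open>spin_surjective\<close>), and it is equivariant (\<open>spin_double_action\<close>).  The
  invariants of the Clifford algebra are therefore the equivariant endomorphisms of the exterior
  algebra (\<open>clifford_invariants_iff\<close>), and it remains to see that a completely reducible
  representation is multiplicity-free if and only if its equivariant endomorphisms commute.

  The identification avoids counting dimensions.  For a basis \<open>b\<close> of \<open>V\<close> with dual basis \<open>b\<^sup>*\<close>, let
  \<open>p\<close> be the product of the idempotents \<open>b\<^sup>* b\<close> of the Clifford algebra.  It is the vacuum
  projector: it is killed by functionals from the left and by vectors from the right, and it acts
  on the exterior algebra as the projection to the constants.  The anticommutation relations
  show that the two-sided ideal generated by \<open>p\<close> is everything (\<open>vacuum_full\<close>), so that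
  statements about the Clifford algebra only need to be checked on elements \<open>x p y\<close>, which act as
  operators of rank at most one.  Faithfulness, fullness and the finite dimension of the exterior
  algebra all follow in this way.

  Suppose that every irreducible occurs at most once.  Then an equivariant endomorphism acts on
  an irreducible subspace \<open>W\<close> by a scalar, since it and the inclusion both lie in the line
  \<open>Hom\<^sub>G(W, \<Lambda> V)\<close>.  For two such endomorphisms \<open>S\<close> and \<open>T\<close>, an invariant complement of the kernel
  of \<open>S T - T S\<close> contains no irreducible subspace, hence vanishes.  Conversely, suppose that
  equivariant endomorphisms commute, and let \<open>f \<noteq> 0\<close> and \<open>h\<close> be equivariant maps from an
  irreducible \<open>W\<close>.  An equivariant projection \<open>P\<close> with \<open>P f = id\<close> gives commuting endomorphisms
  \<open>f P\<close> and \<open>h P\<close>, so \<open>h = f P h\<close>; thus \<open>h P\<close> preserves the image of \<open>f\<close>, and an eigenvector there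
  shows by Schur's argument that \<open>h\<close> is a multiple of \<open>f\<close>.
\<close>

section \<open>Representations of free algebras\<close>

lemma complex_linearD:
  assumes "complex_linear f"
  shows complex_linear_add: "f (x + y) = f x + f y"
    and complex_linear_scaleC: "f (c *\<^sub>C x) = c *\<^sub>C f x"
    and complex_linear_zero: "f 0 = 0"
    and complex_linear_diff: "f (x - y) = f x - f y"
    and complex_linear_uminus: "f (- x) = - f x"
    and complex_linear_sum: "f (sum h A) = (\<Sum>a\<in>A. f (h a))"
proof -
  have hom: "module_hom scaleC scaleC f"
    using assms by (simp add: Vector_Spaces.linear_def)
  show "f (x + y) = f x + f y" "f (c *\<^sub>C x) = c *\<^sub>C f x" "f 0 = 0" "f (x - y) = f x - f y"
    "f (- x) = - f x" "f (sum h A) = (\<Sum>a\<in>A. f (h a))"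
    by (simp_all add: module_hom.add[OF hom] module_hom.scale[OF hom] module_hom.zero[OF hom]
        module_hom.diff[OF hom] module_hom.neg[OF hom] module_hom.sum[OF hom])
qed

lemma complex_linearI:
  assumes "\<And>x y. f (x + y) = f x + f y" "\<And>c x. f (c *\<^sub>C x) = c *\<^sub>C f x"
  shows "complex_linear f"
  using assms by (simp add: complex_linear_iff)

lemma scaleC_simps [simp]:
  fixes x :: "'a::complex_vector"
  shows "0 *\<^sub>C x = 0" "c *\<^sub>C (0::'a) = 0" "1 *\<^sub>C x = x"
    "(- c) *\<^sub>C x = - (c *\<^sub>C x)" "c *\<^sub>C (- x) = - (c *\<^sub>C x)"
  by (simp_all add: scaleC_one)

definition word_act :: "('a \<Rightarrow> 'e \<Rightarrow> 'e) \<Rightarrow> 'a free_word \<Rightarrow> 'e \<Rightarrow> 'e"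
  where "word_act \<gamma> w = foldr \<gamma> (letters w)"

definition free_act :: "('a \<Rightarrow> 'e::complex_vector \<Rightarrow> 'e) \<Rightarrow> 'a free_algebra \<Rightarrow> 'e \<Rightarrow> 'e"
  where "free_act \<gamma> p x =
    (\<Sum>w\<in>Poly_Mapping.keys p. Poly_Mapping.lookup p w *\<^sub>C word_act \<gamma> w x)"

lemma free_act_superset:
  assumes "finite A" "Poly_Mapping.keys p \<subseteq> A"
  shows "free_act \<gamma> p x = (\<Sum>w\<in>A. Poly_Mapping.lookup p w *\<^sub>C word_act \<gamma> w x)"
  unfolding free_act_def
  by (rule sum.mono_neutral_left) (use assms in \<open>auto simp: in_keys_iff\<close>)

lemma free_act_add: "free_act \<gamma> (p + q) x = free_act \<gamma> p x + free_act \<gamma> q x"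
proof -
  let ?A = "Poly_Mapping.keys p \<union> Poly_Mapping.keys q"
  have "Poly_Mapping.keys (p + q) \<subseteq> ?A" by (rule keys_add)
  then show ?thesis
    by (simp add: free_act_superset[of ?A] lookup_add scaleC_add_left sum.distrib)
qed

lemma free_act_zero [simp]: "free_act \<gamma> 0 x = 0"
  by (simp add: free_act_def)

lemma free_act_single: "free_act \<gamma> (Poly_Mapping.single w c) x = c *\<^sub>C word_act \<gamma> w x"
  by (simp add: free_act_superset[of "{w}"])

lemma free_algebra_decompose:
  "p = (\<Sum>w\<in>Poly_Mapping.keys p. Poly_Mapping.single w (Poly_Mapping.lookup p w))"
  by (rule poly_mapping_eqI)
    (auto simp: lookup_sum lookup_single when_def in_keys_iff sum.delta)

lemma free_algebra_induct [case_names single add]: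
  assumes single: "\<And>w c. P (Poly_Mapping.single w c)"
    and add: "\<And>p q. P p \<Longrightarrow> P q \<Longrightarrow> P (p + q)"
  shows "P (p :: 'a free_algebra)"
proof -
  have "P (\<Sum>w\<in>A. Poly_Mapping.single w (Poly_Mapping.lookup p w))" if "finite A" for A
    using that
  proof (induction A)
    case empty
    show ?case using single[of 0 0] by simp
  qed (simp add: add single)
  then show ?thesis
    by (subst free_algebra_decompose) simp
qed

lemma word_act_linear:
  assumes "\<And>a. complex_linear (\<gamma> a)"
  shows "complex_linear (word_act \<gamma> w)"
proof -
  have "complex_linear (foldr \<gamma> us)" for us
    by (induction us) (simp_all add: complex_linear_iff complex_linearD[OF assms])
  then show ?thesis by (simp add: word_act_def)
qed

lemma free_act_linear:
  assumes "\<And>a. complex_linear (\<gamma> a)"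
  shows "complex_linear (free_act \<gamma> p)"
proof (rule complex_linearI)
  note lin = complex_linearD[OF word_act_linear[of \<gamma>, OF assms]]
  show "free_act \<gamma> p (x + y) = free_act \<gamma> p x + free_act \<gamma> p y" for x y
    by (simp add: free_act_def lin scaleC_add_right sum.distrib)
  show "free_act \<gamma> p (c *\<^sub>C x) = c *\<^sub>C free_act \<gamma> p x" for c x
    by (simp add: free_act_def lin scaleC_scaleC mult.commute
        complex_vector.scale_sum_right)
qed

lemma free_act_mult:
  assumes "\<And>a. complex_linear (\<gamma> a)"
  shows "free_act \<gamma> (p * q) x = free_act \<gamma> p (free_act \<gamma> q x)"
proof -
  note lin = complex_linearD[OF word_act_linear[of \<gamma>, OF assms]]
  note flin = complex_linearD[OF free_act_linear[of \<gamma>, OF assms]]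
  show ?thesis
  proof (induction p rule: free_algebra_induct)
    case (single v c)
    show ?case
    proof (induction q rule: free_algebra_induct)
      case (single w d)
      have "word_act \<gamma> (v + w) x = word_act \<gamma> v (word_act \<gamma> w x)"
        by (simp add: word_act_def plus_free_word_def)
      then show ?case
        by (simp add: mult_single free_act_single lin scaleC_scaleC)
    qed (simp add: distrib_left free_act_add flin)
  qed (simp add: distrib_right free_act_add)
qed

lemma free_act_const [simp]: "free_act \<gamma> (free_const c) x = c *\<^sub>C x"
  by (simp add: free_const_def free_act_single word_act_def zero_free_word_def)

lemma free_act_one [simp]: "free_act \<gamma> 1 x = x"
  using free_act_const[of \<gamma> 1 x] by (simp add: free_const_one)

lemma free_act_gen [simp]: "free_act \<gamma> (free_gen a) x = \<gamma> a x"
  by (simp add: free_gen_def free_act_single word_act_def)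

lemma free_act_uminus: "free_act \<gamma> (- p) x = - free_act \<gamma> p x"
  using free_act_add[of \<gamma> p "- p" x] by (simp add: eq_neg_iff_add_eq_0 add.commute)

lemma free_act_diff: "free_act \<gamma> (p - q) x = free_act \<gamma> p x - free_act \<gamma> q x"
  using free_act_add[of \<gamma> p "- q" x] by (simp add: free_act_uminus)

lemma free_const_commute: "p * free_const c = free_const c * p"
proof (induction p rule: free_algebra_induct)
  case (single w d)
  then show ?case by (simp add: free_const_def mult_single mult.commute)
qed (simp add: algebra_simps)

section \<open>Algebras presented by generators and relations\<close>

text \<open>
  The exterior and the Clifford algebra are treated alike: \<open>proj\<close> is the quotient map from the
  free algebra and \<open>rep\<close> a choice of representatives.
\<close>

locale presented_algebra =
  fixes proj :: "'a free_algebra \<Rightarrow> 'b::{complex_vector, ring, monoid_mult}"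
    and rep :: "'b \<Rightarrow> 'a free_algebra"
    and S :: "'a free_algebra set"
  assumes proj_rep: "proj (rep x) = x"
    and proj_eq_iff: "proj p = proj q \<longleftrightarrow> cong_modulo S p q"
    and proj_add: "proj (p + q) = proj p + proj q"
    and proj_mult: "proj (p * q) = proj p * proj q"
    and proj_one: "proj 1 = 1"
    and proj_scaleC: "proj (free_const c * p) = c *\<^sub>C proj p"
begin

definition gen :: "'a \<Rightarrow> 'b"
  where "gen a = proj (free_gen a)"

text \<open>
  A family of operators, one for each generator, that satisfies the relations; by
  \<open>act_simps\<close> this is the same as a representation of the algebra.
\<close>

definition admissible :: "('a \<Rightarrow> 'e::complex_vector \<Rightarrow> 'e) \<Rightarrow> bool"
  where "admissible \<gamma> \<longleftrightarrow> (\<forall>a. complex_linear (\<gamma> a)) \<and> (\<forall>s\<in>S. \<forall>x. free_act \<gamma> s x = 0)"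

definition act :: "('a \<Rightarrow> 'e::complex_vector \<Rightarrow> 'e) \<Rightarrow> 'b \<Rightarrow> 'e \<Rightarrow> 'e"
  where "act \<gamma> x = free_act \<gamma> (rep x)"

lemma scaleC_eq_mult: "c *\<^sub>C (x::'b) = proj (free_const c) * x"
  using proj_scaleC[of c "rep x"] by (simp add: proj_mult proj_rep)

lemma scaleC_mult_left: "(c *\<^sub>C (x::'b)) * y = c *\<^sub>C (x * y)"
  by (simp add: scaleC_eq_mult mult.assoc)

lemma scaleC_mult_right: "(x::'b) * (c *\<^sub>C y) = c *\<^sub>C (x * y)"
proof -
  have "x * proj (free_const c) = proj (free_const c) * x"
    using free_const_commute[of "rep x" c] by (metis proj_mult proj_rep)
  then show ?thesis
    by (simp add: scaleC_eq_mult mult.assoc[symmetric])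
qed

lemma mult_left_linear: "complex_linear (\<lambda>y. (x::'b) * y)"
  by (simp add: complex_linear_iff distrib_left scaleC_mult_right)

lemma proj_zero: "proj 0 = 0"
  using proj_add[of 0 0] by simp

lemma proj_uminus: "proj (- p) = - proj p"
  using proj_add[of p "- p"] by (simp add: proj_zero eq_neg_iff_add_eq_0 add.commute)

lemma proj_diff: "proj (p - q) = proj p - proj q"
  using proj_add[of p "- q"] by (simp add: proj_uminus)

lemma proj_const: "proj (free_const c) = c *\<^sub>C 1"
  using proj_scaleC[of c 1] by (simp add: proj_one)

lemma proj_relation: "s \<in> S \<Longrightarrow> proj s = 0"
  using two_sided_ideal.gen[of s S 1 1] proj_eq_iff[of s 0]
  by (simp add: cong_modulo_def proj_zero)

lemma act_proj:
  assumes "admissible \<gamma>"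
  shows "act \<gamma> (proj p) x = free_act \<gamma> p x"
proof -
  have lin: "complex_linear (\<gamma> a)" for a
    using assms by (simp add: admissible_def)
  note mult = free_act_mult[of \<gamma>, OF lin]
  note flin = complex_linearD[OF free_act_linear[of \<gamma>, OF lin]]
  have ideal: "free_act \<gamma> q y = 0" if "q \<in> two_sided_ideal S" for q y
    using that
  proof (induction arbitrary: y rule: two_sided_ideal.induct)
    case (gen s a b)
    then show ?case
      using assms by (simp add: mult admissible_def flin)
  qed (simp_all add: free_act_add)
  have "rep (proj p) - p \<in> two_sided_ideal S"
    using proj_eq_iff[of "rep (proj p)" p] by (simp add: proj_rep cong_modulo_def)
  then show ?thesis
    using ideal[of "rep (proj p) - p" x] by (simp add: act_def free_act_diff)
qed

lemma act_simps:
  assumes "admissible \<gamma>"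
  shows act_add: "act \<gamma> (x + y) z = act \<gamma> x z + act \<gamma> y z"
    and act_scaleC: "act \<gamma> (c *\<^sub>C x) z = c *\<^sub>C act \<gamma> x z"
    and act_mult: "act \<gamma> (x * y) z = act \<gamma> x (act \<gamma> y z)"
    and act_one: "act \<gamma> 1 z = z"
    and act_gen: "act \<gamma> (gen a) z = \<gamma> a z"
    and act_zero: "act \<gamma> 0 z = 0"
proof -
  have lin: "complex_linear (\<gamma> a)" for a
    using assms by (simp add: admissible_def)
  note [simp] = free_act_mult[of \<gamma>, OF lin] free_act_add act_proj[OF assms]
  show "act \<gamma> (x + y) z = act \<gamma> x z + act \<gamma> y z"
    using act_proj[OF assms, of "rep x + rep y" z] by (simp add: proj_add proj_rep act_def)
  show "act \<gamma> (c *\<^sub>C x) z = c *\<^sub>C act \<gamma> x z"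
    using act_proj[OF assms, of "free_const c * rep x" z]
    by (simp add: proj_scaleC proj_rep act_def)
  show "act \<gamma> (x * y) z = act \<gamma> x (act \<gamma> y z)"
    using act_proj[OF assms, of "rep x * rep y" z] by (simp add: proj_mult proj_rep act_def)
  show "act \<gamma> 1 z = z"
    using act_proj[OF assms, of 1 z] by (simp add: proj_one)
  show "act \<gamma> (gen a) z = \<gamma> a z"
    by (simp add: gen_def)
  show "act \<gamma> 0 z = 0"
    using act_proj[OF assms, of 0 z] by (simp add: proj_zero)
qed

lemma act_linear:
  assumes "admissible \<gamma>"
  shows "complex_linear (act \<gamma> x)"
  using assms by (auto simp: act_def admissible_def intro: free_act_linear)

lemma algebra_induct [case_names one add scaleC gen_mult]:
  assumes one: "P 1"
    and add: "\<And>x y. P x \<Longrightarrow> P y \<Longrightarrow> P (x + y)"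
    and scaleC: "\<And>c x. P x \<Longrightarrow> P (c *\<^sub>C x)"
    and gen: "\<And>a x. P x \<Longrightarrow> P (gen a * x)"
  shows "P x"
proof -
  have "P (proj p)" for p
  proof (induction p rule: free_algebra_induct)
    case (single w c)
    have "P (proj (Poly_Mapping.single (Word us) 1))" for us
    proof (induction us)
      case Nil
      have "Poly_Mapping.single (Word []) 1 = (1 :: 'a free_algebra)"
        by (metis single_one zero_free_word_def)
      then show ?case using one by (simp add: proj_one)
    next
      case (Cons u us)
      have "Poly_Mapping.single (Word (u # us)) 1 = free_gen u * Poly_Mapping.single (Word us) 1"
        by (simp add: free_gen_def mult_single plus_free_word_def)
      then show ?case using gen[OF Cons] by (simp add: proj_mult gen_def)
    qed
    then have "P (proj (Poly_Mapping.single (Word (letters w)) 1))" .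
    moreover have "Poly_Mapping.single w c = free_const c * Poly_Mapping.single (Word (letters w)) 1"
      by (simp add: free_const_def mult_single)
    ultimately have "proj (Poly_Mapping.single w c) = c *\<^sub>C proj (Poly_Mapping.single (Word (letters w)) 1)"
      by (simp only: proj_scaleC)
    then show ?case
      using scaleC[OF \<open>P (proj (Poly_Mapping.single (Word (letters w)) 1))\<close>] by (simp only:)
  qed (simp add: proj_add add)
  then show ?thesis by (metis proj_rep)
qed

text \<open>
  This turns the induced endomorphism into the orbit map of the unit for a representation, so that
  it inherits its properties from \<open>act_simps\<close> as soon as the left multiplications by \<open>gen (h a)\<close>
  satisfy the relations.
\<close>

lemma proj_free_map_rep:
  fixes h :: "'a \<Rightarrow> 'a"
  shows "proj (free_map h (rep x)) = act (\<lambda>a y. gen (h a) * y) x 1"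
proof -
  have sum: "proj (sum f A) = (\<Sum>w\<in>A. proj (f w))" for f and A :: "'c set"
    by (induction A rule: infinite_finite_induct) (simp_all add: proj_zero proj_add)
  have word: "proj (Poly_Mapping.single (map_free_word h w) 1) = word_act (\<lambda>a y. gen (h a) * y) w 1"
    for w
  proof -
    have "proj (Poly_Mapping.single (Word (map h us)) 1) = foldr (\<lambda>a y. gen (h a) * y) us 1" for us
    proof (induction us)
      case Nil
      have "Poly_Mapping.single (Word []) 1 = (1 :: 'a free_algebra)"
        by (metis single_one zero_free_word_def)
      then show ?case by (simp add: proj_one)
    next
      case (Cons u us)
      have "Poly_Mapping.single (Word (h u # map h us)) 1
          = free_gen (h u) * Poly_Mapping.single (Word (map h us)) 1"
        by (simp add: free_gen_def mult_single plus_free_word_def)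
      then show ?case using Cons by (simp add: proj_mult gen_def)
    qed
    then show ?thesis by (cases w) (simp add: word_act_def)
  qed
  have "proj (Poly_Mapping.single (map_free_word h w) c)
      = c *\<^sub>C word_act (\<lambda>a y. gen (h a) * y) w 1" for w c
    using proj_scaleC[of c "Poly_Mapping.single (map_free_word h w) 1"]
    by (simp add: word free_const_def mult_single)
  then show ?thesis
    by (simp add: free_map_def sum act_def free_act_def)
qed

end

lemma free_act_tensor_relations:
  assumes "\<And>v w x. \<gamma> (v + w) x = \<gamma> v x + \<gamma> w x" "\<And>c v x. \<gamma> (c *\<^sub>C v) x = c *\<^sub>C \<gamma> v x"
    and "\<And>a. complex_linear (\<gamma> a)"
    and "s \<in> tensor_relations"
  shows "free_act \<gamma> s x = 0"
  using assms(4)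
  by (auto simp: tensor_relations_def free_act_diff free_act_add free_act_mult[of \<gamma>, OF assms(3)] assms(1,2))

lemma gen_linear:
  fixes proj :: "'a::complex_vector free_algebra \<Rightarrow> 'b::{complex_vector, ring, monoid_mult}"
  assumes "presented_algebra proj rep S" and "tensor_relations \<subseteq> S"
  shows "complex_linear (presented_algebra.gen proj)"
proof -
  interpret presented_algebra proj rep S by fact
  show ?thesis
  proof (rule complex_linearI)
    show "gen (v + w) = gen v + gen w" for v w
      using assms(2) proj_relation[of "free_gen (v + w) - (free_gen v + free_gen w)"]
      by (force simp: tensor_relations_def proj_diff proj_add gen_def)
    show "gen (c *\<^sub>C v) = c *\<^sub>C gen v" for c v
      using assms(2) proj_relation[of "free_gen (c *\<^sub>C v) - free_const c * free_gen v"]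
      by (force simp: tensor_relations_def proj_diff proj_scaleC gen_def)
  qed
qed

section \<open>Contractions on the exterior algebra\<close>

lemma exterior_presented: "presented_algebra abs_exterior rep_exterior exterior_relations"
proof
  show "abs_exterior (rep_exterior x) = x" for x :: "'v::complex_vector exterior"
    by (rule Quotient3_abs_rep[OF Quotient3_exterior])
qed (simp_all add: exterior.abs_eq_iff plus_exterior.abs_eq times_exterior.abs_eq
    one_exterior_def scaleC_exterior.abs_eq)

interpretation ext: presented_algebra abs_exterior rep_exterior exterior_relations
  by (rule exterior_presented)

lemma ext_admissibleI:
  fixes \<gamma> :: "'v::complex_vector \<Rightarrow> 'e::complex_vector \<Rightarrow> 'e"
  assumes "\<And>v w x. \<gamma> (v + w) x = \<gamma> v x + \<gamma> w x" "\<And>c v x. \<gamma> (c *\<^sub>C v) x = c *\<^sub>C \<gamma> v x"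
    and "\<And>v x y. \<gamma> v (x + y) = \<gamma> v x + \<gamma> v y" "\<And>c v x. \<gamma> v (c *\<^sub>C x) = c *\<^sub>C \<gamma> v x"
    and "\<And>v x. \<gamma> v (\<gamma> v x) = 0"
  shows "ext.admissible \<gamma>"
proof -
  have lin: "complex_linear (\<gamma> v)" for v
    using assms(3,4) by (rule complex_linearI)
  show ?thesis
    unfolding ext.admissible_def
    using free_act_tensor_relations[of \<gamma>, OF assms(1,2) lin]
    by (auto simp: lin exterior_relations_def free_act_mult[of \<gamma>, OF lin] assms(5))
qed

lemma ext_gen_linear: "complex_linear ext.gen"
  by (rule gen_linear[OF exterior_presented]) (simp add: exterior_relations_def)

lemmas ext_linear_simps =
  complex_linearD[OF ext_gen_linear] complex_linearD[OF ext.mult_left_linear]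
  ext.scaleC_mult_left

lemma ext_gen_square: "ext.gen v * ext.gen v = 0"
  using ext.proj_relation[of "free_gen v * free_gen v"]
  by (force simp: exterior_relations_def ext.gen_def ext.proj_mult)

lemma ext_gen_gen: "ext.gen v * (ext.gen v * x) = 0"
  by (simp add: mult.assoc[symmetric] ext_gen_square)

lemma dual_apply_linear: "complex_linear (dual_apply \<mu>)"
  using dual_apply[of \<mu>] by simp

lemma dual_apply_simps [simp]:
  "dual_apply \<mu> (v + w) = dual_apply \<mu> v + dual_apply \<mu> w"
  "dual_apply \<mu> (c *\<^sub>C v) = c * dual_apply \<mu> v"
  "dual_apply \<mu> 0 = 0"
  "dual_apply (\<mu> + \<nu>) v = dual_apply \<mu> v + dual_apply \<nu> v"
  "dual_apply (c *\<^sub>C \<mu>) v = c * dual_apply \<mu> v"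
  "dual_apply 0 v = 0"
  by (simp_all add: complex_linearD[OF dual_apply_linear] plus_dual.rep_eq scaleC_dual.rep_eq
      zero_dual.rep_eq scaleC_complex_def)

text \<open>
  The universal property yields representations rather than antiderivations \<open>\<delta>\<close>.  But left
  multiplication by a vector acts on the pairs \<open>(x, \<delta> x)\<close> by the operators below, which square to
  zero, so these pairs form an orbit of a representation on pairs.
\<close>

definition contraction_step ::
    "'v dual \<Rightarrow> 'v::complex_vector \<Rightarrow> 'v exterior \<times> 'v exterior \<Rightarrow> 'v exterior \<times> 'v exterior"
  where "contraction_step \<mu> v z =
    (ext.gen v * fst z, dual_apply \<mu> v *\<^sub>C fst z - ext.gen v * snd z)"

definition contraction :: "'v::complex_vector dual \<Rightarrow> 'v exterior \<Rightarrow> 'v exterior"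
  where "contraction \<mu> x = snd (ext.act (contraction_step \<mu>) x (1, 0))"

lemma contraction_step_admissible: "ext.admissible (contraction_step \<mu>)"
  by (rule ext_admissibleI)
    (simp_all add: contraction_step_def scaleC_prod_def ext_linear_simps ext_gen_gen
      scaleC_add_left scaleC_add_right scaleC_scaleC distrib_right mult.commute
      complex_vector.scale_right_diff_distrib zero_prod_def)

lemmas contraction_step_act = ext.act_simps[OF contraction_step_admissible]

lemma contraction_step_simps:
  "fst (contraction_step \<mu> v z) = ext.gen v * fst z"
  "snd (contraction_step \<mu> v z) = dual_apply \<mu> v *\<^sub>C fst z - ext.gen v * snd z"
  by (simp_all add: contraction_step_def)

lemma fst_contraction_act: "fst (ext.act (contraction_step \<mu>) x (1, 0)) = x"
  by (induction x rule: ext.algebra_induct)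
    (simp_all add: contraction_step_act contraction_step_simps scaleC_prod_def)

lemma contraction_one [simp]: "contraction \<mu> 1 = 0"
  by (simp add: contraction_def contraction_step_act)

lemma contraction_add: "contraction \<mu> (x + y) = contraction \<mu> x + contraction \<mu> y"
  by (simp add: contraction_def contraction_step_act)

lemma contraction_scaleC: "contraction \<mu> (c *\<^sub>C x) = c *\<^sub>C contraction \<mu> x"
  by (simp add: contraction_def contraction_step_act scaleC_prod_def)

lemma contraction_linear: "complex_linear (contraction \<mu>)"
  by (rule complex_linearI) (simp_all add: contraction_add contraction_scaleC)

lemmas contraction_simps = complex_linearD[OF contraction_linear]

lemma contraction_gen_mult:
  "contraction \<mu> (ext.gen v * x) = dual_apply \<mu> v *\<^sub>C x - ext.gen v * contraction \<mu> x"
  by (simp add: contraction_def contraction_step_act contraction_step_simps fst_contraction_act)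

lemma contraction_dual_add: "contraction (\<mu> + \<nu>) x = contraction \<mu> x + contraction \<nu> x"
  by (induction x rule: ext.algebra_induct)
    (simp_all add: contraction_simps scaleC_add_right scaleC_add_left contraction_gen_mult
      ext_linear_simps algebra_simps)

lemma contraction_dual_scaleC: "contraction (c *\<^sub>C \<mu>) x = c *\<^sub>C contraction \<mu> x"
  by (induction x rule: ext.algebra_induct)
    (simp_all add: contraction_simps scaleC_add_right contraction_gen_mult
      ext_linear_simps complex_vector.scale_right_diff_distrib scaleC_scaleC mult.commute)

text \<open>
  In \<open>\<mu>(\<nu>(v x)) + \<nu>(\<mu>(v x))\<close> the terms in which \<open>v\<close> is contracted cancel, so
  left multiplication by \<open>v\<close> can be pulled out and induction applies.
\<close>

lemma contraction_anticommute:
  "contraction \<mu> (contraction \<nu> x) + contraction \<nu> (contraction \<mu> x) = 0"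
proof (induction x rule: ext.algebra_induct)
  case (add x y)
  have "contraction \<mu> (contraction \<nu> (x + y)) + contraction \<nu> (contraction \<mu> (x + y))
    = (contraction \<mu> (contraction \<nu> x) + contraction \<nu> (contraction \<mu> x))
      + (contraction \<mu> (contraction \<nu> y) + contraction \<nu> (contraction \<mu> y))"
    by (simp add: contraction_simps)
  then show ?case by (simp add: add)
next
  case (scaleC c x)
  then show ?case
    by (simp add: contraction_simps scaleC_add_right[symmetric])
next
  case (gen_mult v x)
  have "contraction \<mu> (contraction \<nu> (ext.gen v * x)) + contraction \<nu> (contraction \<mu> (ext.gen v * x))
    = ext.gen v * (contraction \<mu> (contraction \<nu> x) + contraction \<nu> (contraction \<mu> x))"
    by (simp add: contraction_simps contraction_gen_mult ext_linear_simps distrib_left)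
  then show ?case by (simp only: gen_mult) simp
qed (simp add: contraction_simps)

section \<open>The spin representation\<close>

lemma clifford_presented:
  "presented_algebra abs_clifford rep_clifford (clifford_relations canonical_pairing)"
proof
  show "abs_clifford (rep_clifford x) = x" for x :: "'v::complex_vector clifford"
    by (rule Quotient3_abs_rep[OF Quotient3_clifford])
qed (simp_all add: clifford.abs_eq_iff plus_clifford.abs_eq times_clifford.abs_eq
    one_clifford_def scaleC_clifford.abs_eq)

interpretation cl: presented_algebra abs_clifford rep_clifford
    "clifford_relations canonical_pairing"
  by (rule clifford_presented)

lemma cl_admissibleI:
  fixes \<gamma> :: "'v::complex_vector \<times> 'v dual \<Rightarrow> 'e::complex_vector \<Rightarrow> 'e"
  assumes "\<And>v w x. \<gamma> (v + w) x = \<gamma> v x + \<gamma> w x" "\<And>c v x. \<gamma> (c *\<^sub>C v) x = c *\<^sub>C \<gamma> v x"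
    and "\<And>v x y. \<gamma> v (x + y) = \<gamma> v x + \<gamma> v y" "\<And>c v x. \<gamma> v (c *\<^sub>C x) = c *\<^sub>C \<gamma> v x"
    and "\<And>v w x. \<gamma> v (\<gamma> w x) + \<gamma> w (\<gamma> v x) = canonical_pairing v w *\<^sub>C x"
  shows "cl.admissible \<gamma>"
proof -
  have lin: "complex_linear (\<gamma> v)" for v
    using assms(3,4) by (rule complex_linearI)
  show ?thesis
    unfolding cl.admissible_def
    using free_act_tensor_relations[of \<gamma>, OF assms(1,2) lin]
    by (auto simp: lin clifford_relations_def free_act_mult[of \<gamma>, OF lin]
        free_act_add free_act_diff assms(5))
qed

lemma cl_gen_linear: "complex_linear cl.gen"
  by (rule gen_linear[OF clifford_presented]) (simp add: clifford_relations_def)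

lemmas cl_linear_simps =
  complex_linearD[OF cl_gen_linear] complex_linearD[OF cl.mult_left_linear]
  cl.scaleC_mult_left

lemma cl_anticommute:
  "cl.gen v * cl.gen w + cl.gen w * cl.gen v = canonical_pairing v w *\<^sub>C 1"
proof -
  let ?r = "free_gen v * free_gen w + free_gen w * free_gen v - free_const (canonical_pairing v w)"
  have "?r \<in> clifford_relations canonical_pairing"
    unfolding clifford_relations_def by blast
  then show ?thesis
    using cl.proj_relation[of ?r]
    by (simp add: cl.gen_def cl.proj_mult cl.proj_add cl.proj_diff cl.proj_const)
qed

lemma cl_square:
  assumes "canonical_pairing v v = 0"
  shows "cl.gen v * cl.gen v = 0"
proof -
  \<comment> \<open>The relation only gives twice the square.\<close>
  have "(1 + 1) *\<^sub>C (cl.gen v * cl.gen v) = cl.gen v * cl.gen v + cl.gen v * cl.gen v"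
    by (simp only: scaleC_add_left scaleC_one)
  also have "\<dots> = 0"
    using cl_anticommute[of v v] assms by simp
  finally show ?thesis
    by (simp only: complex_vector.scale_eq_0_iff) simp
qed

definition spin_gen :: "'v::complex_vector \<times> 'v dual \<Rightarrow> 'v exterior \<Rightarrow> 'v exterior"
  where "spin_gen z x = ext.gen (fst z) * x + contraction (snd z) x"

definition spin :: "'v::complex_vector clifford \<Rightarrow> 'v exterior \<Rightarrow> 'v exterior"
  where "spin = cl.act spin_gen"

lemma spin_gen_anticommute:
  "spin_gen v (spin_gen w x) + spin_gen w (spin_gen v x) = canonical_pairing v w *\<^sub>C x"
proof -
  let ?v = "ext.gen (fst v)" and ?w = "ext.gen (fst w)"
  have "?v * ?w + ?w * ?v = 0"
    using ext_gen_square[of "fst v + fst w"]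
    by (simp add: ext_linear_simps distrib_left distrib_right ext_gen_square add.commute)
  then have "?v * (?w * x) + ?w * (?v * x) = 0"
    by (simp add: mult.assoc[symmetric] distrib_right[symmetric])
  moreover have "contraction (snd v) (contraction (snd w) x)
      + contraction (snd w) (contraction (snd v) x) = 0"
    by (rule contraction_anticommute)
  moreover have "spin_gen v (spin_gen w x) + spin_gen w (spin_gen v x)
    = (?v * (?w * x) + ?w * (?v * x))
      + (contraction (snd v) (contraction (snd w) x)
        + contraction (snd w) (contraction (snd v) x))
      + canonical_pairing v w *\<^sub>C x"
    by (simp add: spin_gen_def contraction_simps contraction_gen_mult distrib_left
        canonical_pairing_def scaleC_add_left)
  ultimately show ?thesis
    by (simp only:) simp
qed

lemma spin_admissible: "cl.admissible spin_gen"
  by (rule cl_admissibleI)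
    (simp_all only: spin_gen_anticommute,
      simp_all add: spin_gen_def ext_linear_simps contraction_simps contraction_dual_add
      contraction_dual_scaleC distrib_right scaleC_prod_def scaleC_add_right)

lemmas spin_simps = cl.act_simps[OF spin_admissible, folded spin_def]

lemma spin_linear: "complex_linear (spin a)"
  unfolding spin_def by (rule cl.act_linear[OF spin_admissible])

section \<open>The vacuum projector\<close>

text \<open>
  Annihilators \<open>a\<close> and creators \<open>c\<close> in any ring.  Each \<open>a i * c i\<close> is an idempotent that commutes
  with \<open>a j\<close> and \<open>c j\<close> for all other \<open>j\<close>.  For the last claim, \<open>1 = a k c k + c k a k\<close> and
  \<open>c k a k = c k (a k c k) a k\<close> show that each factor of the product can be removed without leaving
  the two-sided ideal that the product generates; this is stated for any additively closed set that
  contains the elements \<open>x * P xs * y\<close>.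
\<close>

lemma canonical_anticommutation:
  fixes a c :: "'i \<Rightarrow> 'r::{ring, monoid_mult}"
  assumes ac: "\<And>i j. i \<in> I \<Longrightarrow> j \<in> I \<Longrightarrow> a i * c j + c j * a i = (if i = j then 1 else 0)"
    and aa: "\<And>i j. i \<in> I \<Longrightarrow> j \<in> I \<Longrightarrow> a i * a j + a j * a i = 0" "\<And>i. i \<in> I \<Longrightarrow> a i * a i = 0"
    and cc: "\<And>i j. i \<in> I \<Longrightarrow> j \<in> I \<Longrightarrow> c i * c j + c j * c i = 0" "\<And>i. i \<in> I \<Longrightarrow> c i * c i = 0"
  defines "P \<equiv> \<lambda>xs. prod_list (map (\<lambda>i. a i * c i) xs)"
  shows annihilator_vacuum: "\<lbrakk>set xs \<subseteq> I; i \<in> set xs\<rbrakk> \<Longrightarrow> a i * P xs = 0"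
    and vacuum_creator: "\<lbrakk>set xs \<subseteq> I; i \<in> set xs; distinct xs\<rbrakk> \<Longrightarrow> P xs * c i = 0"
    and vacuum_full: "\<lbrakk>\<And>x y. x \<in> J \<Longrightarrow> y \<in> J \<Longrightarrow> x + y \<in> J; \<And>x y. x * P xs * y \<in> J;
      set xs \<subseteq> I; distinct xs\<rbrakk> \<Longrightarrow> 1 \<in> J"
proof -
  have anti: "x * (y * z) = - (y * (x * z))" if "x * y + y * x = 0" for x y z :: 'r
  proof -
    have "x * (y * z) + y * (x * z) = (x * y + y * x) * z"
      by (simp only: distrib_right mult.assoc)
    then show ?thesis using that by (simp add: eq_neg_iff_add_eq_0)
  qed
  have aN: "a i * ((a j * c j) * z) = (a j * c j) * (a i * z)"
    and cN: "c i * ((a j * c j) * z) = (a j * c j) * (c i * z)"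
    if "i \<in> I" "j \<in> I" "i \<noteq> j" for i j z
    using anti[of "a i" "a j" "c j * z"] anti[of "a i" "c j" z]
      anti[of "c i" "a j" "c j * z"] anti[of "c i" "c j" z] that
    by (simp_all add: ac aa(1) cc(1) mult.assoc add.commute)
  have PP: "a i * P xs = P xs * a i \<and> c i * P xs = P xs * c i"
    if "i \<in> I" "set xs \<subseteq> I" "i \<notin> set xs" for i xs
    using that
  proof (induction xs)
    case (Cons j xs)
    have "a i * P (j # xs) = a i * ((a j * c j) * P xs)" "c i * P (j # xs) = c i * ((a j * c j) * P xs)"
      by (simp_all add: P_def)
    moreover have "a i * ((a j * c j) * P xs) = (a j * c j) * (a i * P xs)"
      "c i * ((a j * c j) * P xs) = (a j * c j) * (c i * P xs)"
      using Cons.prems by (intro aN cN; auto)+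
    moreover have "a i * P xs = P xs * a i" "c i * P xs = P xs * c i"
      using Cons by simp_all
    ultimately show ?case
      by (simp add: P_def mult.assoc)
  qed (simp add: P_def)
  then have aP: "a i * P xs = P xs * a i" and cP: "c i * P xs = P xs * c i"
    if "i \<in> I" "set xs \<subseteq> I" "i \<notin> set xs" for i xs
    using that by blast+
  have cac: "c i * (a i * (c i * z)) = c i * z"
    and aaz: "a i * (a i * z) = 0" and ccz: "c i * (c i * z) = 0" if "i \<in> I" for i z
  proof -
    have sum: "a i * (c i * y) + c i * (a i * y) = y" for y
      using arg_cong[OF ac[OF that that], of "\<lambda>x. x * y"] by (simp add: distrib_right mult.assoc)
    show aaz: "a i * (a i * z) = 0" and ccz: "c i * (c i * z) = 0"
      using aa(2)[OF that] cc(2)[OF that] by (simp_all add: mult.assoc[symmetric])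
    show "c i * (a i * (c i * z)) = c i * z"
      using sum[of "c i * z"] ccz by simp
  qed
  show "a i * P xs = 0" if "set xs \<subseteq> I" "i \<in> set xs"
    using that
  proof (induction xs)
    case (Cons j xs)
    show ?case
    proof (cases "i = j")
      case True
      with Cons show ?thesis by (simp add: P_def mult.assoc aaz)
    next
      case False
      with Cons have "a i * ((a j * c j) * P xs) = (a j * c j) * (a i * P xs)"
        by (intro aN) auto
      with False Cons show ?thesis by (simp add: P_def)
    qed
  qed simp
  show "P xs * c i = 0" if "set xs \<subseteq> I" "i \<in> set xs" "distinct xs"
    using that
  proof (induction xs)
    case (Cons j xs)
    show ?case
    proof (cases "i = j")
      case True
      with Cons have "P xs * c i = c i * P xs"
        by (intro cP[symmetric]) auto
      with True Cons show ?thesis by (simp add: P_def mult.assoc ccz)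
    next
      case False
      with Cons show ?thesis by (simp add: P_def mult.assoc)
    qed
  qed simp
  show "1 \<in> J" if "\<And>x y. x \<in> J \<Longrightarrow> y \<in> J \<Longrightarrow> x + y \<in> J" "\<And>x y. x * P xs * y \<in> J"
      "set xs \<subseteq> I" "distinct xs"
    using that(2-)
  proof (induction xs)
    case Nil
    then show ?case using Nil(1)[of 1 1] by (simp add: P_def)
  next
    case (Cons k xs)
    have k: "k \<in> I" "set xs \<subseteq> I" "k \<notin> set xs" using Cons.prems by auto
    have "x * P xs * y \<in> J" for x y
    proof -
      have "c k * P (k # xs) * a k = c k * (a k * (c k * (P xs * a k)))"
        by (simp add: P_def mult.assoc)
      also have "\<dots> = c k * (a k * P xs)"
        using k by (simp add: cac aP)
      finally have "P xs = P (k # xs) + c k * P (k # xs) * a k"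
        using ac[OF k(1) k(1)]
        by (simp add: P_def mult.assoc[symmetric] distrib_right[symmetric])
      then have "x * P xs * y = x * (P (k # xs) + c k * P (k # xs) * a k) * y"
        by (rule arg_cong)
      also have "\<dots> = x * P (k # xs) * y + (x * c k) * P (k # xs) * (a k * y)"
        by (simp only: distrib_left distrib_right mult.assoc)
      finally have "x * P xs * y = x * P (k # xs) * y + (x * c k) * P (k # xs) * (a k * y)" .
      then show ?thesis using that(1) Cons.prems(1) by simp
    qed
    then show ?case using Cons k by simp
  qed
qed

text \<open>
  Vectors are isotropic in \<open>V \<oplus> V\<^sup>*\<close>, so the exterior algebra of \<open>V\<close> maps to the Clifford algebra.
\<close>

definition clifford_of_exterior :: "'v::complex_vector exterior \<Rightarrow> 'v clifford"
  where "clifford_of_exterior x = ext.act (\<lambda>v y. cl.gen (v, 0) * y) x 1"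

lemma clifford_of_exterior_admissible:
  "ext.admissible (\<lambda>v y. cl.gen (v, 0) * (y :: 'v::complex_vector clifford))"
proof (rule ext_admissibleI)
  show "cl.gen (v + w, 0) * y = cl.gen (v, 0) * y + cl.gen (w, 0) * y" for v w :: 'v and y
    using complex_linear_add[OF cl_gen_linear, of "(v, 0)" "(w, 0)"] by (simp add: distrib_right)
  show "cl.gen (c *\<^sub>C v, 0) * y = c *\<^sub>C (cl.gen (v, 0) * y)" for c and v :: 'v and y
    using complex_linear_scaleC[OF cl_gen_linear, of c "(v, 0)"]
    by (simp add: scaleC_prod_def cl.scaleC_mult_left)
  show "cl.gen (v, 0) * (cl.gen (v, 0) * y) = 0" for v :: 'v and y
    by (simp add: mult.assoc[symmetric] cl_square canonical_pairing_def)
qed (simp_all add: cl_linear_simps distrib_left)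

lemmas clifford_of_exterior_act = ext.act_simps[OF clifford_of_exterior_admissible]

lemma clifford_of_exterior_simps:
  "clifford_of_exterior 1 = 1"
  "clifford_of_exterior (x + y) = clifford_of_exterior x + clifford_of_exterior y"
  "clifford_of_exterior (c *\<^sub>C x) = c *\<^sub>C clifford_of_exterior x"
  "clifford_of_exterior (ext.gen v * x) = cl.gen (v, 0) * clifford_of_exterior x"
  by (simp_all add: clifford_of_exterior_def clifford_of_exterior_act)

lemma clifford_of_exterior_linear: "complex_linear clifford_of_exterior"
  by (rule complex_linearI) (simp_all add: clifford_of_exterior_simps)

lemma contraction_zero [simp]: "contraction 0 x = 0"
  using contraction_dual_scaleC[of 0 0 x] by simp

lemma spin_clifford_of_exterior: "spin (clifford_of_exterior x) y = x * y"
  by (induction x rule: ext.algebra_induct)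
    (simp_all add: clifford_of_exterior_simps spin_simps spin_gen_def ext_linear_simps
      distrib_right mult.assoc)

lemma finite_basis_UNIV:
  fixes B0 :: "'v::complex_vector set"
  assumes "finite B0" "complex_vector.span B0 = UNIV"
  obtains B where "finite B" "complex_vector.independent B" "complex_vector.span B = (UNIV :: 'v set)"
proof -
  obtain B where B: "B \<subseteq> B0" "complex_vector.independent B" "B0 \<subseteq> complex_vector.span B"
    using complex_vector.maximal_independent_subset by blast
  have "complex_vector.span B = UNIV"
    using complex_vector.span_mono[OF B(3)] assms(2) by (auto simp: complex_vector.span_span)
  then show ?thesis
    using that B finite_subset[OF B(1) assms(1)] by blast
qed

definition coordinate :: "'v::complex_vector set \<Rightarrow> 'v \<Rightarrow> 'v dual"
  where "coordinate B b = Abs_dual (\<lambda>v. complex_vector.representation B v b)"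

lemma dual_apply_coordinate:
  assumes "complex_vector.independent B" "complex_vector.span B = UNIV"
  shows "dual_apply (coordinate B b) v = complex_vector.representation B v b"
proof -
  have "complex_linear (\<lambda>v. complex_vector.representation B v b)"
    by (rule complex_linearI)
      (simp_all add: complex_vector.representation_add complex_vector.representation_scale
        assms scaleC_complex_def)
  then show ?thesis
    by (simp add: coordinate_def Abs_dual_inverse)
qed

lemma basis_expansion:
  assumes "finite B" "complex_vector.independent B" "complex_vector.span B = UNIV"
  shows "v = (\<Sum>b\<in>B. dual_apply (coordinate B b) v *\<^sub>C b)"
  using complex_vector.sum_representation_eq[of B v B] assms by (simp add: dual_apply_coordinate)

lemma coordinate_basis:
  assumes "complex_vector.independent B" "complex_vector.span B = UNIV" "c \<in> B"
  shows "dual_apply (coordinate B b) c = (if b = c then 1 else 0)"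
  using assms by (auto simp: dual_apply_coordinate complex_vector.representation_basis)

lemma dual_basis_expansion:
  assumes "finite B" "complex_vector.independent B" "complex_vector.span B = UNIV"
  shows "\<mu> = (\<Sum>b\<in>B. dual_apply \<mu> b *\<^sub>C coordinate B b)"
proof -
  have sum: "dual_apply (sum f A) v = (\<Sum>a\<in>A. dual_apply (f a) v)" for f and A :: "'a set" and v
    by (induction A rule: infinite_finite_induct) simp_all
  have "dual_apply \<mu> v = dual_apply (\<Sum>b\<in>B. dual_apply \<mu> b *\<^sub>C coordinate B b) v" for v
  proof -
    have "dual_apply \<mu> v = dual_apply \<mu> (\<Sum>b\<in>B. dual_apply (coordinate B b) v *\<^sub>C b)"
      using basis_expansion[OF assms, of v] by simp
    also have "\<dots> = (\<Sum>b\<in>B. dual_apply (coordinate B b) v * dual_apply \<mu> b)"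
      by (simp add: complex_linear_sum[OF dual_apply_linear])
    finally show ?thesis by (simp add: sum mult.commute)
  qed
  then show ?thesis
    by (metis dual_apply_inject ext)
qed

text \<open>
  The projector is \<open>\<Prod> b\<^sup>* b\<close> for a basis \<open>b\<close>.  The last property is the induction
  principle by which everything else is reduced to elements \<open>x * p * y\<close>.
\<close>

lemma vacuum_projector_exists:
  fixes B0 :: "'v::complex_vector set"
  assumes "finite B0" "complex_vector.span B0 = UNIV"
  obtains p :: "'v clifford"
  where "\<And>\<mu>. cl.gen (0, \<mu>) * p = 0" "\<And>v. p * cl.gen (v, 0) = 0" "spin p 1 = 1"
    and "\<And>J. \<lbrakk>\<And>x y. x \<in> J \<Longrightarrow> y \<in> J \<Longrightarrow> x + y \<in> J; \<And>x y. x * p * y \<in> J\<rbrakk> \<Longrightarrow> 1 \<in> J"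
proof -
  obtain B where B: "finite B" "complex_vector.independent B"
    "complex_vector.span B = (UNIV :: 'v set)"
    using finite_basis_UNIV[OF assms] .
  obtain xs where xs: "set xs = B" "distinct xs"
    using finite_distinct_list[OF B(1)] by blast
  define a where "a b = (cl.gen (0, coordinate B b) :: 'v clifford)" for b
  define c where "c b = (cl.gen (b, 0) :: 'v clifford)" for b
  define p where "p = (\<Prod>b\<leftarrow>xs. a b * c b)"
  have car: "i \<in> B \<Longrightarrow> j \<in> B \<Longrightarrow> a i * c j + c j * a i = (if i = j then 1 else 0)"
    "a i * a j + a j * a i = 0" "a i * a i = 0" "c i * c j + c j * c i = 0" "c i * c i = 0" for i j
    by (auto simp: a_def c_def cl_anticommute cl_square canonical_pairing_def
        coordinate_basis[OF B(2,3)])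
  note vac = annihilator_vacuum[of B a c xs, OF car, folded p_def]
    vacuum_creator[of B a c xs, OF car, folded p_def]
    vacuum_full[of B a c _ xs, OF car, folded p_def]
  have "cl.gen (0, \<mu>) * p = 0" for \<mu>
  proof -
    have "(0, \<mu>) = (\<Sum>b\<in>B. dual_apply \<mu> b *\<^sub>C (0 :: 'v, coordinate B b))"
      using dual_basis_expansion[OF B, of \<mu>]
      by (auto simp: prod_eq_iff fst_sum snd_sum scaleC_prod_def)
    then have "cl.gen (0, \<mu>) * p = (\<Sum>b\<in>B. dual_apply \<mu> b *\<^sub>C (a b * p))"
      by (simp add: a_def complex_linearD[OF cl_gen_linear] sum_distrib_right
          cl.scaleC_mult_left)
    then show ?thesis using vac(1) xs by simp
  qed
  moreover have "p * cl.gen (v, 0) = 0" for v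
  proof -
    have "(v, 0) = (\<Sum>b\<in>B. dual_apply (coordinate B b) v *\<^sub>C (b, 0 :: 'v dual))"
      using basis_expansion[OF B, of v]
      by (auto simp: prod_eq_iff fst_sum snd_sum scaleC_prod_def)
    then have "p * cl.gen (v, 0) = (\<Sum>b\<in>B. dual_apply (coordinate B b) v *\<^sub>C (p * c b))"
      by (simp add: c_def cl_linear_simps)
    then show ?thesis using vac(2) xs by simp
  qed
  moreover have "spin p 1 = 1"
  proof -
    have "spin (\<Prod>b\<leftarrow>ys. a b * c b) 1 = 1" if "set ys \<subseteq> B" for ys
      using that
    proof (induction ys)
      case (Cons y ys)
      have "contraction (coordinate B y) (ext.gen y * 1) = dual_apply (coordinate B y) y *\<^sub>C 1"
        by (simp only: contraction_gen_mult contraction_one mult_zero_right diff_zero)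
      with Cons show ?case
        by (simp add: spin_simps a_def c_def spin_gen_def complex_linearD[OF ext_gen_linear]
            coordinate_basis[OF B(2,3)])
    qed (simp add: spin_simps)
    then show ?thesis using xs by (simp add: p_def)
  qed
  moreover have "1 \<in> J" if "\<And>x y. x \<in> J \<Longrightarrow> y \<in> J \<Longrightarrow> x + y \<in> J" "\<And>x y. x * p * y \<in> J" for J
    using vac(3)[of J] that xs by blast
  ultimately show ?thesis using that by blast
qed

text \<open>
  Every \<open>x\<close> is a constant plus a sum of terms that begin with a vector, and \<open>p\<close> kills the latter.
\<close>

lemma vacuum_projector_rank_one:
  assumes "\<And>v. p * cl.gen (v, 0) = 0" "spin p 1 = 1"
  obtains c where "spin p x = c *\<^sub>C 1"
proof -
  have "\<exists>c. p * clifford_of_exterior x = c *\<^sub>C p"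
  proof (induction x rule: ext.algebra_induct)
    case one
    show ?case by (rule exI[of _ 1]) (simp add: clifford_of_exterior_simps)
  next
    case (add x y)
    then obtain c d where "p * clifford_of_exterior x = c *\<^sub>C p" "p * clifford_of_exterior y = d *\<^sub>C p"
      by blast
    then show ?case
      by (intro exI[of _ "c + d"])
        (simp add: clifford_of_exterior_simps distrib_left scaleC_add_left)
  next
    case (scaleC k x)
    then obtain c where "p * clifford_of_exterior x = c *\<^sub>C p" by blast
    then show ?case
      by (intro exI[of _ "k * c"])
        (simp add: clifford_of_exterior_simps cl_linear_simps scaleC_scaleC)
  next
    case (gen_mult v x)
    show ?case
      by (rule exI[of _ 0]) (simp add: clifford_of_exterior_simps mult.assoc[symmetric] assms)
  qed
  then obtain c where c: "p * clifford_of_exterior x = c *\<^sub>C p" by blast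
  have "spin p x = spin (p * clifford_of_exterior x) 1"
    by (simp add: spin_simps spin_clifford_of_exterior)
  then show ?thesis
    using that[of c] by (simp add: c spin_simps assms(2))
qed

text \<open>
  The left ideal generated by the vacuum is a copy of the spin representation: a functional moves to
  the right through the vectors by the Clifford relation, exactly as a contraction does, and is
  killed by \<open>p\<close> when it arrives there.
\<close>

lemma clifford_of_exterior_spin:
  assumes p: "\<And>\<mu>. cl.gen (0, \<mu>) * p = 0"
  shows "clifford_of_exterior (spin a x) * p = a * clifford_of_exterior x * p"
proof -
  note coe = complex_linearD[OF clifford_of_exterior_linear] clifford_of_exterior_simps
  have contr: "clifford_of_exterior (contraction \<mu> y) * p = cl.gen (0, \<mu>) * clifford_of_exterior y * p"
    for \<mu> y
  proof (induction y rule: ext.algebra_induct)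
    case (gen_mult w y)
    let ?y = "clifford_of_exterior y * p"
    have "cl.gen (0, \<mu>) * cl.gen (w, 0) = dual_apply \<mu> w *\<^sub>C 1 - cl.gen (w, 0) * cl.gen (0, \<mu>)"
      using cl_anticommute[of "(0, \<mu>)" "(w, 0)"]
      by (simp add: canonical_pairing_def eq_diff_eq)
    then have "cl.gen (0, \<mu>) * (cl.gen (w, 0) * ?y)
      = dual_apply \<mu> w *\<^sub>C ?y - cl.gen (w, 0) * (cl.gen (0, \<mu>) * ?y)"
      by (simp only: mult.assoc[symmetric]) (simp add: left_diff_distrib cl.scaleC_mult_left)
    with gen_mult show ?case
      by (simp add: contraction_gen_mult coe left_diff_distrib cl.scaleC_mult_left mult.assoc)
  qed (simp_all add: contraction_simps coe p distrib_left distrib_right cl_linear_simps mult.assoc)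
  show ?thesis
  proof (induction a rule: cl.algebra_induct)
    case (gen_mult z a)
    let ?y = "clifford_of_exterior x * p"
    have "clifford_of_exterior (spin (cl.gen z * a) x) * p
      = cl.gen (fst z, 0) * (a * ?y) + cl.gen (0, snd z) * (a * ?y)"
      using gen_mult by (simp add: spin_simps spin_gen_def coe distrib_right contr mult.assoc)
    also have "\<dots> = (cl.gen (fst z, 0) + cl.gen (0, snd z)) * (a * ?y)"
      by (simp only: distrib_right)
    also have "cl.gen (fst z, 0) + cl.gen (0, snd z) = cl.gen z"
      using complex_linear_add[OF cl_gen_linear, of "(fst z, 0)" "(0, snd z)"] by simp
    finally show ?case by (simp only: mult.assoc)
  qed (simp_all add: spin_simps coe distrib_right cl.scaleC_mult_left mult.assoc)
qed

text \<open>
  An element \<open>x p\<close> is determined by the value of \<open>x\<close> on the unit.  So if \<open>a\<close> and \<open>b\<close> act alike, then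
  \<open>a x p y = b x p y\<close> for all \<open>x\<close> and \<open>y\<close>, and such products add up to the unit.
\<close>

lemma spin_injective:
  fixes B0 :: "'v::complex_vector set"
  assumes fin: "finite B0" "complex_vector.span B0 = UNIV"
    and eq: "\<And>x :: 'v exterior. spin a x = spin b x"
  shows "a = b"
proof -
  obtain p :: "'v clifford" where p: "\<And>\<mu>. cl.gen (0, \<mu>) * p = 0"
    and full: "\<And>J. \<lbrakk>\<And>x y. x \<in> J \<Longrightarrow> y \<in> J \<Longrightarrow> x + y \<in> J; \<And>x y. x * p * y \<in> J\<rbrakk> \<Longrightarrow> 1 \<in> J"
    using vacuum_projector_exists[OF fin] by metis
  have spin_p: "x * p = clifford_of_exterior (spin x 1) * p" for x
    by (simp add: clifford_of_exterior_spin[OF p] clifford_of_exterior_simps)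
  have "1 \<in> {y. a * y = b * y}"
  proof (rule full)
    fix x y
    have "(a * x) * p = (b * x) * p"
      by (simp add: spin_p[of "a * x"] spin_p[of "b * x"] spin_simps eq)
    then show "x * p * y \<in> {y. a * y = b * y}"
      by (simp add: mult.assoc[symmetric])
  qed (simp add: distrib_left)
  then show ?thesis by simp
qed

text \<open>
  As \<open>p\<close> projects to the constants, \<open>T (x p y)\<close> acts like \<open>u p y\<close>, where \<open>u\<close> is multiplication by
  the value of \<open>T x\<close> on the unit.  The unit is a sum of such \<open>x p y\<close>.
\<close>

lemma spin_surjective:
  fixes B0 :: "'v::complex_vector set"
  assumes fin: "finite B0" "complex_vector.span B0 = UNIV"
    and T: "complex_linear (T :: 'v exterior \<Rightarrow> 'v exterior)"
  obtains a where "\<And>x. spin a x = T x"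
proof -
  note T = complex_linearD[OF T]
  obtain p :: "'v clifford" where p: "\<And>v. p * cl.gen (v, 0) = 0" "spin p 1 = 1"
    and full: "\<And>J. \<lbrakk>\<And>x y. x \<in> J \<Longrightarrow> y \<in> J \<Longrightarrow> x + y \<in> J; \<And>x y. x * p * y \<in> J\<rbrakk> \<Longrightarrow> 1 \<in> J"
    using vacuum_projector_exists[OF fin] by metis
  have "1 \<in> {y. \<exists>a. \<forall>u. spin a u = T (spin y u)}"
  proof (rule full)
    fix x y
    assume "x \<in> {y. \<exists>a. \<forall>u. spin a u = T (spin y u)}" "y \<in> {y. \<exists>a. \<forall>u. spin a u = T (spin y u)}"
    then obtain a b where "\<forall>u. spin a u = T (spin x u)" "\<forall>u. spin b u = T (spin y u)"
      by auto
    then have "\<forall>u. spin (a + b) u = T (spin (x + y) u)"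
      by (simp add: spin_simps T)
    then show "x + y \<in> {y. \<exists>a. \<forall>u. spin a u = T (spin y u)}" by blast
  next
    fix x y
    have "spin (clifford_of_exterior (T (spin x 1)) * p * y) u = T (spin (x * p * y) u)" for u
    proof -
      obtain c where "spin p (spin y u) = c *\<^sub>C 1"
        using vacuum_projector_rank_one[OF p] .
      then show ?thesis
        by (simp add: spin_simps spin_clifford_of_exterior ext_linear_simps T
            complex_linearD[OF spin_linear])
    qed
    then show "x * p * y \<in> {y. \<exists>a. \<forall>u. spin a u = T (spin y u)}" by blast
  qed
  then show ?thesis using that by (auto simp: spin_simps)
qed

text \<open>
  The identity is a sum of operators \<open>x p y\<close> of rank at most one.
\<close>

lemma exterior_finite_dimensional:
  fixes B0 :: "'v::complex_vector set"
  assumes fin: "finite B0" "complex_vector.span B0 = UNIV"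
  obtains C where "finite C" "complex_vector.span C = (UNIV :: 'v exterior set)"
proof -
  obtain p :: "'v clifford" where p: "\<And>v. p * cl.gen (v, 0) = 0" "spin p 1 = 1"
    and full: "\<And>J. \<lbrakk>\<And>x y. x \<in> J \<Longrightarrow> y \<in> J \<Longrightarrow> x + y \<in> J; \<And>x y. x * p * y \<in> J\<rbrakk> \<Longrightarrow> 1 \<in> J"
    using vacuum_projector_exists[OF fin] by metis
  let ?J = "{y :: 'v clifford. \<exists>C. finite C \<and> (\<forall>u. spin y u \<in> complex_vector.span C)}"
  have "1 \<in> ?J"
  proof (rule full)
    fix x y
    assume "x \<in> ?J" "y \<in> ?J"
    then obtain C D where "finite C" "finite D"
      and CD: "spin x u \<in> complex_vector.span C" "spin y u \<in> complex_vector.span D" for u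
      by auto
    then have "finite (C \<union> D)" by simp
    moreover have "spin (x + y) u \<in> complex_vector.span (C \<union> D)" for u
      unfolding spin_simps complex_vector.span_Un using CD by blast
    ultimately show "x + y \<in> ?J" by blast
  next
    fix x y
    have "spin (x * p * y) u \<in> complex_vector.span {spin x 1}" for u
    proof -
      obtain c where "spin p (spin y u) = c *\<^sub>C 1"
        using vacuum_projector_rank_one[OF p] .
      then show ?thesis
        by (simp add: spin_simps complex_linearD[OF spin_linear]
            complex_vector.span_scale complex_vector.span_base)
    qed
    then show "x * p * y \<in> ?J" by blast
  qed
  then show ?thesis using that by (auto simp: spin_simps)
qed

section \<open>Equivariance of the spin representation\<close>

lemma exterior_map_admissible:
  assumes "complex_linear h"
  shows "ext.admissible (\<lambda>v y. ext.gen (h v) * y)"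
  by (rule ext_admissibleI)
    (simp_all add: complex_linearD[OF assms] ext_linear_simps distrib_right ext_gen_gen)

lemma exterior_map_eq_act: "exterior_map h x = ext.act (\<lambda>v y. ext.gen (h v) * y) x 1"
  by (simp add: exterior_map_def ext.proj_free_map_rep)

lemma exterior_map_simps:
  assumes "complex_linear h"
  shows "exterior_map h 1 = 1"
    and "exterior_map h (x + y) = exterior_map h x + exterior_map h y"
    and "exterior_map h (c *\<^sub>C x) = c *\<^sub>C exterior_map h x"
    and "exterior_map h (ext.gen v * x) = ext.gen (h v) * exterior_map h x"
  by (simp_all add: exterior_map_eq_act ext.act_simps[OF exterior_map_admissible[OF assms]])

lemma exterior_map_linear: "complex_linear h \<Longrightarrow> complex_linear (exterior_map h)"
  by (rule complex_linearI) (simp_all add: exterior_map_simps)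

lemma exterior_map_compose:
  assumes "complex_linear h" "complex_linear k" "\<And>v. m v = h (k v)"
  shows "exterior_map m x = exterior_map h (exterior_map k x)"
proof -
  have "complex_linear m"
    using assms by (simp add: complex_linear_iff)
  then show ?thesis
    by (induction x rule: ext.algebra_induct) (simp_all add: exterior_map_simps assms)
qed

lemma exterior_map_identity:
  assumes "\<And>v. h v = v"
  shows "exterior_map h x = x"
proof -
  have "complex_linear h"
    using assms by (simp add: complex_linear_iff)
  then show ?thesis
    by (induction x rule: ext.algebra_induct) (simp_all add: exterior_map_simps assms)
qed

lemma clifford_map_admissible:
  assumes "complex_linear H" "\<And>z w. canonical_pairing (H z) (H w) = canonical_pairing z w"
  shows "cl.admissible (\<lambda>z y. cl.gen (H z) * y)"
proof (rule cl_admissibleI)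
  show "cl.gen (H z) * (cl.gen (H w) * y) + cl.gen (H w) * (cl.gen (H z) * y)
      = canonical_pairing z w *\<^sub>C y" for z w y
    using arg_cong[OF cl_anticommute[of "H z" "H w"], of "\<lambda>u. u * y"]
    by (simp add: distrib_right mult.assoc cl.scaleC_mult_left assms(2))
qed (simp_all add: complex_linearD[OF assms(1)] cl_linear_simps distrib_right)

lemma clifford_map_simps:
  assumes "complex_linear H" "\<And>z w. canonical_pairing (H z) (H w) = canonical_pairing z w"
  shows "clifford_map H 1 = 1"
    and "clifford_map H (x + y) = clifford_map H x + clifford_map H y"
    and "clifford_map H (c *\<^sub>C x) = c *\<^sub>C clifford_map H x"
    and "clifford_map H (cl.gen z * x) = cl.gen (H z) * clifford_map H x"
proof -
  have eq: "clifford_map H x = cl.act (\<lambda>z y. cl.gen (H z) * y) x 1" for x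
    by (simp add: clifford_map_def cl.proj_free_map_rep)
  show "clifford_map H 1 = 1"
    "clifford_map H (x + y) = clifford_map H x + clifford_map H y"
    "clifford_map H (c *\<^sub>C x) = c *\<^sub>C clifford_map H x"
    "clifford_map H (cl.gen z * x) = cl.gen (H z) * clifford_map H x"
    by (simp_all add: eq cl.act_simps[OF clifford_map_admissible[OF assms]])
qed

lemma contraction_equivariant:
  assumes "complex_linear h" "\<And>v. dual_apply \<nu> (h v) = dual_apply \<mu> v"
  shows "contraction \<nu> (exterior_map h x) = exterior_map h (contraction \<mu> x)"
  by (induction x rule: ext.algebra_induct)
    (simp_all add: exterior_map_simps[OF assms(1)] contraction_simps contraction_gen_mult assms(2)
      complex_linearD[OF exterior_map_linear[OF assms(1)]])

lemma spin_equivariant: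
  assumes h: "complex_linear h" and H: "complex_linear H"
    and fst: "\<And>z. fst (H z) = h (fst z)"
    and snd: "\<And>z v. dual_apply (snd (H z)) (h v) = dual_apply (snd z) v"
  shows "spin (clifford_map H a) (exterior_map h x) = exterior_map h (spin a x)"
proof -
  have isometry: "canonical_pairing (H z) (H w) = canonical_pairing z w" for z w
    by (simp add: canonical_pairing_def fst snd)
  show ?thesis
    by (induction a arbitrary: x rule: cl.algebra_induct)
      (simp_all add: clifford_map_simps[OF H isometry] spin_simps spin_gen_def fst
        exterior_map_simps[OF h] contraction_equivariant[OF h snd])
qed

lemma group_inverse:
  assumes "linear_algebraic_group G" "g \<in> G"
  shows "matrix_inv g \<in> G" "g ** matrix_inv g = mat 1" "matrix_inv g ** g = mat 1"
proof -
  have "invertible g"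
    using assms by (auto simp: linear_algebraic_group_def)
  then have "\<exists>h. g ** h = mat 1 \<and> h ** g = mat 1"
    by (simp add: invertible_def)
  then show "g ** matrix_inv g = mat 1" "matrix_inv g ** g = mat 1"
    unfolding matrix_inv_def by (rule someI2_ex; simp)+
  show "matrix_inv g \<in> G"
    using assms by (auto simp: linear_algebraic_group_def)
qed

lemma regular_representation_linear:
  assumes "regular_representation G UNIV \<rho>" "g \<in> G"
  shows "complex_linear (\<rho> g)"
  using assms by (intro complex_linearI) (auto simp: regular_representation_def)

lemma regular_representation_inverse:
  assumes "linear_algebraic_group G" "regular_representation G UNIV \<rho>" "g \<in> G"
  shows "\<rho> g (\<rho> (matrix_inv g) v) = v" "\<rho> (matrix_inv g) (\<rho> g v) = v"
proof -
  have "\<rho> (a ** b) v = \<rho> a (\<rho> b v)" if "a \<in> G" "b \<in> G" for a b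
    using assms(2) that by (simp add: regular_representation_def)
  moreover have "\<rho> (mat 1) v = v"
    using assms(2) by (simp add: regular_representation_def)
  ultimately show "\<rho> g (\<rho> (matrix_inv g) v) = v" "\<rho> (matrix_inv g) (\<rho> g v) = v"
    using group_inverse[OF assms(1,3)] assms(3) by metis+
qed

lemma dual_apply_dual_action:
  assumes "linear_algebraic_group G" "regular_representation G UNIV \<rho>" "g \<in> G"
  shows "dual_apply (dual_action \<rho> g \<mu>) v = dual_apply \<mu> (\<rho> (matrix_inv g) v)"
proof -
  have "complex_linear (\<lambda>v. dual_apply \<mu> (\<rho> (matrix_inv g) v))"
    using regular_representation_linear[OF assms(2) group_inverse(1)[OF assms(1,3)]]
    by (simp add: complex_linear_iff scaleC_complex_def)
  then show ?thesis by (simp add: dual_action_def Abs_dual_inverse)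
qed

lemma spin_double_action:
  assumes "linear_algebraic_group G" "regular_representation G UNIV \<rho>" "g \<in> G"
  shows "spin (clifford_map (double_action \<rho> g) a) (exterior_map (\<rho> g) x)
    = exterior_map (\<rho> g) (spin a x)"
proof (rule spin_equivariant)
  show lin: "complex_linear (\<rho> g)"
    using assms(2,3) by (rule regular_representation_linear)
  note dual = dual_apply_dual_action[OF assms]
  have "dual_action \<rho> g (\<mu> + \<nu>) = dual_action \<rho> g \<mu> + dual_action \<rho> g \<nu>"
    "dual_action \<rho> g (c *\<^sub>C \<mu>) = c *\<^sub>C dual_action \<rho> g \<mu>" for \<mu> \<nu> c
    by (simp_all add: dual_apply_inject[symmetric] fun_eq_iff dual)
  then show "complex_linear (double_action \<rho> g)"
    by (intro complex_linearI)
      (simp_all add: double_action_def scaleC_prod_def complex_linearD[OF lin])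
  show "dual_apply (snd (double_action \<rho> g z)) (\<rho> g v) = dual_apply (snd z) v" for z v
    by (simp add: double_action_def dual regular_representation_inverse[OF assms])
qed (simp add: double_action_def)

text \<open>
  By equivariance, \<open>g a\<close> acts as the conjugate of the action of \<open>a\<close> by \<open>g\<close>; the action is faithful.
\<close>

lemma clifford_invariants_iff:
  fixes \<rho> :: "complex^'n^'n \<Rightarrow> 'v::complex_vector \<Rightarrow> 'v"
  assumes "linear_algebraic_group G" "regular_representation G UNIV \<rho>"
  shows "a \<in> clifford_invariants G \<rho> \<longleftrightarrow>
    (\<forall>g\<in>G. \<forall>x. spin a (exterior_map (\<rho> g) x) = exterior_map (\<rho> g) (spin a x))"
proof -
  obtain B where B: "finite B" "complex_vector.span B = (UNIV :: 'v set)"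
    using assms(2) by (auto simp: regular_representation_def)
  have "clifford_map (double_action \<rho> g) a = a \<longleftrightarrow>
    (\<forall>x. spin a (exterior_map (\<rho> g) x) = exterior_map (\<rho> g) (spin a x))" if g: "g \<in> G" for g
  proof
    assume "clifford_map (double_action \<rho> g) a = a"
    then show "\<forall>x. spin a (exterior_map (\<rho> g) x) = exterior_map (\<rho> g) (spin a x)"
      using spin_double_action[OF assms g, of a] by simp
  next
    assume *: "\<forall>x. spin a (exterior_map (\<rho> g) x) = exterior_map (\<rho> g) (spin a x)"
    show "clifford_map (double_action \<rho> g) a = a"
    proof (rule spin_injective[OF B])
      fix x
      define y where "y = exterior_map (\<rho> (matrix_inv g)) x"
      have "exterior_map (\<rho> g) y = exterior_map (\<lambda>v. \<rho> g (\<rho> (matrix_inv g) v)) x"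
        unfolding y_def
        by (rule exterior_map_compose[symmetric])
          (auto intro: regular_representation_linear[OF assms(2)] g group_inverse[OF assms(1)])
      also have "\<dots> = x"
        by (rule exterior_map_identity) (rule regular_representation_inverse[OF assms g])
      finally show "spin (clifford_map (double_action \<rho> g) a) x = spin a x"
        using spin_double_action[OF assms g, of a y] *[rule_format, of y] by simp
    qed
  qed
  then show ?thesis by (simp add: clifford_invariants_def)
qed

definition equivariant_endomorphism ::
    "'g set \<Rightarrow> ('g \<Rightarrow> 'e::complex_vector \<Rightarrow> 'e) \<Rightarrow> ('e \<Rightarrow> 'e) \<Rightarrow> bool"
  where "equivariant_endomorphism G \<tau> T \<longleftrightarrow>
    complex_linear T \<and> (\<forall>g\<in>G. \<forall>x. T (\<tau> g x) = \<tau> g (T x))"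

lemma clifford_invariants_commute_iff:
  fixes \<rho> :: "complex^'n^'n \<Rightarrow> 'v::complex_vector \<Rightarrow> 'v"
  assumes "linear_algebraic_group G" "regular_representation G UNIV \<rho>"
  shows "(\<forall>x\<in>clifford_invariants G \<rho>. \<forall>y\<in>clifford_invariants G \<rho>. x * y = y * x) \<longleftrightarrow>
    (\<forall>S T. equivariant_endomorphism G (\<lambda>g. exterior_map (\<rho> g)) S \<longrightarrow>
      equivariant_endomorphism G (\<lambda>g. exterior_map (\<rho> g)) T \<longrightarrow> S \<circ> T = T \<circ> S)"
    (is "?L \<longleftrightarrow> ?R")
proof -
  obtain B where B: "finite B" "complex_vector.span B = (UNIV :: 'v set)"
    using assms(2) by (auto simp: regular_representation_def)
  have inv: "a \<in> clifford_invariants G \<rho> \<longleftrightarrow>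
      equivariant_endomorphism G (\<lambda>g. exterior_map (\<rho> g)) (spin a)" for a
    by (simp add: clifford_invariants_iff[OF assms] equivariant_endomorphism_def spin_linear)
  have mult: "spin (a * b) = spin a \<circ> spin b" for a b :: "'v clifford"
    by (simp add: fun_eq_iff spin_simps)
  show ?thesis
  proof
    assume L: ?L
    show ?R
    proof (intro allI impI)
      fix S T
      assume ST: "equivariant_endomorphism G (\<lambda>g. exterior_map (\<rho> g)) S"
        "equivariant_endomorphism G (\<lambda>g. exterior_map (\<rho> g)) T"
      obtain a b where ab: "spin a = S" "spin b = T"
        using spin_surjective[OF B, of S] spin_surjective[OF B, of T] ST
        unfolding equivariant_endomorphism_def by (metis ext)
      then have "a * b = b * a"
        using L ST by (simp add: inv)
      then show "S \<circ> T = T \<circ> S"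
        using ab by (metis mult)
    qed
  next
    assume R: ?R
    show ?L
    proof (intro ballI)
      fix a b
      assume "a \<in> clifford_invariants G \<rho>" "b \<in> clifford_invariants G \<rho>"
      then have "spin (a * b) = spin (b * a)"
        using R by (simp add: inv mult)
      then show "a * b = b * a"
        by (intro spin_injective[OF B]) simp
    qed
  qed
qed

section \<open>The exterior algebra as a regular representation\<close>

lemma polynomial_functions_sum:
  assumes "finite A" "\<And>a. a \<in> A \<Longrightarrow> f a \<in> polynomial_functions"
  shows "(\<lambda>x. \<Sum>a\<in>A. f a x) \<in> polynomial_functions"
  using assms by (induction A) (auto intro: polynomial_functions.intros)

lemma polynomial_functions_prod:
  assumes "finite A" "\<And>a. a \<in> A \<Longrightarrow> f a \<in> polynomial_functions"
  shows "(\<lambda>x. \<Prod>a\<in>A. f a x) \<in> polynomial_functions"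
  using assms by (induction A) (auto intro: polynomial_functions.intros)

lemma polynomial_functions_det_power: "(\<lambda>A. det A ^ k) \<in> polynomial_functions"
proof -
  have "(\<lambda>A :: complex^'n^'n. det A) \<in> polynomial_functions"
    unfolding det_def
    by (intro polynomial_functions_sum polynomial_functions.mult polynomial_functions_prod
        polynomial_functions.const polynomial_functions.entry)
      (simp_all add: finite_permutations)
  then show ?thesis
    by (induction k) (auto intro: polynomial_functions.intros)
qed

lemma regular_on_cong: "(\<And>g. g \<in> G \<Longrightarrow> f g = h g) \<Longrightarrow> regular_on G f \<longleftrightarrow> regular_on G h"
  by (simp add: regular_on_def)

lemma regular_on_const: "regular_on G (\<lambda>_. c)"
  unfolding regular_on_def
  by (rule bexI[of _ "\<lambda>_. c"], rule exI[of _ 0]) (simp_all add: polynomial_functions.const)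

lemma regular_on_add:
  assumes G: "\<And>g. g \<in> G \<Longrightarrow> invertible g" and "regular_on G f" "regular_on G h"
  shows "regular_on G (\<lambda>g. f g + h g)"
proof -
  obtain p q k l where p: "p \<in> polynomial_functions" "\<And>g. g \<in> G \<Longrightarrow> f g = p g / det g ^ k"
    and q: "q \<in> polynomial_functions" "\<And>g. g \<in> G \<Longrightarrow> h g = q g / det g ^ l"
    using assms(2,3) unfolding regular_on_def by blast
  have "f g + h g = (p g * det g ^ l + q g * det g ^ k) / det g ^ (k + l)" if "g \<in> G" for g
  proof -
    have "det g \<noteq> 0" using G[OF that] by (simp add: invertible_det_nz)
    then show ?thesis using p(2) q(2) that by (simp add: power_add add_frac_eq)
  qed
  moreover have "(\<lambda>g. p g * det g ^ l + q g * det g ^ k) \<in> polynomial_functions"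
    by (intro polynomial_functions.add polynomial_functions.mult p(1) q(1)
        polynomial_functions_det_power)
  ultimately show ?thesis
    unfolding regular_on_def by (intro bexI[where x = "\<lambda>g. p g * det g ^ l + q g * det g ^ k"] exI[where x = "k + l"]) auto
qed

lemma regular_on_mult:
  assumes "regular_on G f" "regular_on G h"
  shows "regular_on G (\<lambda>g. f g * h g)"
proof -
  obtain p q k l where p: "p \<in> polynomial_functions" "\<And>g. g \<in> G \<Longrightarrow> f g = p g / det g ^ k"
    and q: "q \<in> polynomial_functions" "\<And>g. g \<in> G \<Longrightarrow> h g = q g / det g ^ l"
    using assms unfolding regular_on_def by blast
  show ?thesis
    unfolding regular_on_def
    by (intro bexI[where x = "\<lambda>g. p g * q g"] exI[where x = "k + l"])
      (auto simp: p(2) q(2) power_add intro: polynomial_functions.mult p(1) q(1))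
qed

lemma regular_on_sum:
  assumes "\<And>g. g \<in> G \<Longrightarrow> invertible g" "finite A" "\<And>a. a \<in> A \<Longrightarrow> regular_on G (f a)"
  shows "regular_on G (\<lambda>g. \<Sum>a\<in>A. f a g)"
  using assms(2,3) by (induction A) (simp_all add: regular_on_const regular_on_add[OF assms(1)])

text \<open>
  Expanding \<open>g v\<close> in a basis of \<open>V\<close>, whose coefficients are regular functions of \<open>g\<close>, reduces the
  matrix coefficients at \<open>v x\<close> to those at \<open>x\<close>.
\<close>

lemma exterior_regular_representation:
  fixes \<rho> :: "complex^'n^'n \<Rightarrow> 'v::complex_vector \<Rightarrow> 'v"
  assumes G: "linear_algebraic_group G" and \<rho>: "regular_representation G UNIV \<rho>"
  shows "regular_representation G UNIV (\<lambda>g. exterior_map (\<rho> g))"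
proof -
  have lin: "complex_linear (\<rho> g)" if "g \<in> G" for g
    using regular_representation_linear[OF \<rho> that] .
  note elin = complex_linearD[OF exterior_map_linear[OF lin]]
  have ginv: "invertible g" if "g \<in> G" for g
    using G that by (auto simp: linear_algebraic_group_def)
  obtain B0 where B0: "finite B0" "complex_vector.span B0 = (UNIV :: 'v set)"
    using \<rho> by (auto simp: regular_representation_def)
  obtain B where B: "finite B" "complex_vector.independent B" "complex_vector.span B = (UNIV :: 'v set)"
    using finite_basis_UNIV[OF B0] .
  obtain C where C: "finite C" "complex_vector.span C = (UNIV :: 'v exterior set)"
    using exterior_finite_dimensional[OF B0] .
  have coeff: "regular_on G (\<lambda>g. \<phi> (exterior_map (\<rho> g) x))" if "complex_linear \<phi>" for \<phi> x
    using that
  proof (induction x arbitrary: \<phi> rule: ext.algebra_induct)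
    case one
    have "regular_on G (\<lambda>g. \<phi> (exterior_map (\<rho> g) 1)) \<longleftrightarrow> regular_on G (\<lambda>_. \<phi> 1)"
      by (rule regular_on_cong) (simp add: exterior_map_simps lin)
    then show ?case by (simp add: regular_on_const)
  next
    case (add x y)
    have "regular_on G (\<lambda>g. \<phi> (exterior_map (\<rho> g) (x + y)))
      \<longleftrightarrow> regular_on G (\<lambda>g. \<phi> (exterior_map (\<rho> g) x) + \<phi> (exterior_map (\<rho> g) y))"
      by (rule regular_on_cong) (simp add: elin complex_linearD[OF add.prems])
    then show ?case using add by (simp add: regular_on_add[OF ginv])
  next
    case (scaleC c x)
    have "regular_on G (\<lambda>g. \<phi> (exterior_map (\<rho> g) (c *\<^sub>C x)))
      \<longleftrightarrow> regular_on G (\<lambda>g. c * \<phi> (exterior_map (\<rho> g) x))"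
      by (rule regular_on_cong) (simp add: elin complex_linearD[OF scaleC.prems] scaleC_complex_def)
    then show ?case using scaleC by (simp add: regular_on_mult regular_on_const)
  next
    case (gen_mult v x)
    note \<phi> = complex_linearD[OF gen_mult.prems]
    let ?c = "\<lambda>b g. dual_apply (coordinate B b) (\<rho> g v)"
    have "\<phi> (exterior_map (\<rho> g) (ext.gen v * x))
      = (\<Sum>b\<in>B. ?c b g * \<phi> (ext.gen b * exterior_map (\<rho> g) x))" if "g \<in> G" for g
    proof -
      have "exterior_map (\<rho> g) (ext.gen v * x)
        = ext.gen (\<Sum>b\<in>B. ?c b g *\<^sub>C b) * exterior_map (\<rho> g) x"
        using that by (simp add: exterior_map_simps lin flip: basis_expansion[OF B])
      also have "\<dots> = (\<Sum>b\<in>B. ?c b g *\<^sub>C (ext.gen b * exterior_map (\<rho> g) x))"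
        by (simp add: ext_linear_simps sum_distrib_right)
      finally show ?thesis by (simp add: \<phi> scaleC_complex_def)
    qed
    then have "regular_on G (\<lambda>g. \<phi> (exterior_map (\<rho> g) (ext.gen v * x)))
      \<longleftrightarrow> regular_on G (\<lambda>g. \<Sum>b\<in>B. ?c b g * \<phi> (ext.gen b * exterior_map (\<rho> g) x))"
      by (rule regular_on_cong)
    moreover have "regular_on G (?c b)" for b
      using \<rho> dual_apply_linear[of "coordinate B b"] unfolding regular_representation_def by blast
    moreover have "regular_on G (\<lambda>g. \<phi> (ext.gen b * exterior_map (\<rho> g) x))" for b
      using gen_mult.IH[of "\<lambda>y. \<phi> (ext.gen b * y)"]
      by (simp add: complex_linear_iff \<phi> ext_linear_simps)
    ultimately show ?case
      by (simp add: regular_on_sum[OF ginv B(1)] regular_on_mult)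
  qed
  have id: "exterior_map (\<rho> (mat 1)) x = x" for x
    by (rule exterior_map_identity) (use \<rho> in \<open>simp add: regular_representation_def\<close>)
  have comp: "exterior_map (\<rho> (g ** h)) x = exterior_map (\<rho> g) (exterior_map (\<rho> h) x)"
    if "g \<in> G" "h \<in> G" for g h x
    using that \<rho> by (intro exterior_map_compose lin) (simp_all add: regular_representation_def)
  show ?thesis
    unfolding regular_representation_def
    using C coeff id comp by (auto simp: elin)
qed

section \<open>Eigenvectors in invariant subspaces\<close>

definition poly_apply :: "('e::complex_vector \<Rightarrow> 'e) \<Rightarrow> complex poly \<Rightarrow> 'e \<Rightarrow> 'e"
  where "poly_apply T p x = (\<Sum>i\<le>degree p. coeff p i *\<^sub>C (T ^^ i) x)"

lemma poly_apply_superset: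
  assumes "degree p \<le> n"
  shows "poly_apply T p x = (\<Sum>i\<le>n. coeff p i *\<^sub>C (T ^^ i) x)"
  unfolding poly_apply_def
  by (rule sum.mono_neutral_left) (use assms in \<open>auto simp: coeff_eq_0\<close>)

lemma poly_apply_linear_factor:
  assumes T: "complex_linear T"
  shows "poly_apply T ([:- z, 1:] * q) x = poly_apply T q (T x - z *\<^sub>C x)"
proof -
  have lin: "complex_linear (T ^^ i)" for i
    by (induction i) (simp_all add: complex_linear_iff complex_linearD[OF T])
  let ?n = "degree q"
  have "degree ([:- z, 1:] * q) \<le> Suc ?n"
    using degree_mult_le[of "[:- z, 1:]" q] by simp
  then have "poly_apply T ([:- z, 1:] * q) x
    = (\<Sum>i\<le>Suc ?n. coeff (pCons 0 q) i *\<^sub>C (T ^^ i) x - (z * coeff q i) *\<^sub>C (T ^^ i) x)"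
    by (simp only: poly_apply_superset)
      (simp add: complex_vector.scale_left_diff_distrib)
  also have "\<dots> = (\<Sum>i\<le>Suc ?n. coeff (pCons 0 q) i *\<^sub>C (T ^^ i) x)
      - (\<Sum>i\<le>Suc ?n. (z * coeff q i) *\<^sub>C (T ^^ i) x)"
    by (rule sum_subtractf)
  also have "(\<Sum>i\<le>Suc ?n. coeff (pCons 0 q) i *\<^sub>C (T ^^ i) x)
      = (\<Sum>i\<le>?n. coeff q i *\<^sub>C (T ^^ i) (T x))"
    by (simp only: sum.atMost_Suc_shift) (simp add: funpow_swap1)
  also have "(\<Sum>i\<le>Suc ?n. (z * coeff q i) *\<^sub>C (T ^^ i) x) = (\<Sum>i\<le>?n. coeff q i *\<^sub>C (T ^^ i) (z *\<^sub>C x))"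
    by (simp add: coeff_eq_0 complex_linearD[OF lin] scaleC_scaleC mult.commute)
  finally show ?thesis
    by (simp add: poly_apply_def complex_linearD[OF lin] complex_vector.scale_right_diff_distrib
        sum_subtractf)
qed

text \<open>
  Split off a linear factor \<open>X - z\<close>: either \<open>u\<close> is an eigenvector for \<open>z\<close>, or \<open>T u - z u\<close> is a nonzero
  vector of \<open>U\<close> that is killed by the remaining factor, which has smaller degree.
\<close>

lemma eigenvector_of_annihilating_poly:
  assumes T: "complex_linear T" and U: "complex_vector.subspace U" "\<And>x. x \<in> U \<Longrightarrow> T x \<in> U"
  shows "\<lbrakk>p \<noteq> 0; u \<in> U; u \<noteq> 0; poly_apply T p u = 0\<rbrakk> \<Longrightarrow>
    \<exists>c. \<exists>w\<in>U. w \<noteq> 0 \<and> T w = c *\<^sub>C w"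
proof (induction "degree p" arbitrary: p u)
  case 0
  then obtain a where "p = [:a:]" "a \<noteq> 0"
    by (metis degree_eq_zeroE pCons_0_0)
  then show ?case using 0 by (simp add: poly_apply_def)
next
  case (Suc n)
  then have "\<not> constant (poly p)"
    by (simp add: constant_degree)
  then obtain z where "poly p z = 0"
    using fundamental_theorem_of_algebra by blast
  then obtain q where q: "p = [:- z, 1:] * q"
    by (auto simp: poly_eq_0_iff_dvd dvd_def)
  then have "q \<noteq> 0" using Suc.prems by auto
  then have deg: "degree q = n"
    using Suc.hyps(2) degree_mult_eq[of "[:- z, 1:]" q] unfolding q[symmetric] by simp
  let ?u = "T u - z *\<^sub>C u"
  show ?case
  proof (cases "?u = 0")
    case True
    then show ?thesis using Suc.prems by auto
  next
    case False
    have "?u \<in> U"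
      using Suc.prems U by (simp add: complex_vector.subspace_diff complex_vector.subspace_scale)
    moreover have "poly_apply T q ?u = 0"
      using Suc.prems(4) by (simp only: q poly_apply_linear_factor[OF T])
    ultimately show ?thesis
      using Suc.hyps(1)[of q ?u] deg \<open>q \<noteq> 0\<close> False by simp
  qed
qed

lemma linear_relation_of_long_sequence:
  fixes x :: "nat \<Rightarrow> 'e::complex_vector"
  assumes "finite C" "complex_vector.span C = (UNIV :: 'e set)"
  obtains c where "\<exists>i\<le>card C. c i \<noteq> 0" "(\<Sum>i\<le>card C. c i *\<^sub>C x i) = 0"
proof (cases "inj_on x {..card C}")
  case True
  have "complex_vector.dependent (x ` {..card C})"
  proof (rule ccontr)
    assume "complex_vector.independent (x ` {..card C})"
    then have "card (x ` {..card C}) \<le> card C"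
      using complex_vector.independent_span_bound[OF assms(1), of "x ` {..card C}"] assms(2)
      by simp
    then show False using True by (simp add: card_image)
  qed
  then obtain u v where "v \<in> x ` {..card C}" "u v \<noteq> 0" "(\<Sum>v\<in>x ` {..card C}. u v *\<^sub>C v) = 0"
    using complex_vector.dependent_finite[of "x ` {..card C}"] by auto
  then show ?thesis
    using that[of "\<lambda>i. u (x i)"] True by (auto simp: sum.reindex)
next
  case False
  then obtain i j where ij: "i \<le> card C" "j \<le> card C" "i \<noteq> j" "x i = x j"
    by (auto simp: inj_on_def)
  \<comment> \<open>A repeated vector is a linear relation in itself.\<close>
  define c where "c k = (if k = i then 1 else 0) - (if k = j then 1 else (0::complex))" for k
  have "(\<Sum>k\<le>card C. c k *\<^sub>C x k)
    = (\<Sum>k\<le>card C. if k = i then x i else 0) - (\<Sum>k\<le>card C. if k = j then x j else 0)"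
    unfolding sum_subtractf[symmetric]
    by (rule sum.cong) (auto simp: c_def complex_vector.scale_left_diff_distrib)
  also have "\<dots> = 0" using ij by simp
  finally have "(\<Sum>k\<le>card C. c k *\<^sub>C x k) = 0" .
  moreover have "c i \<noteq> 0" using ij by (simp add: c_def)
  ultimately show ?thesis
    using that[of c] \<open>c i \<noteq> 0\<close> ij by blast
qed

lemma eigenvector_exists:
  fixes T :: "'e::complex_vector \<Rightarrow> 'e"
  assumes fin: "finite C" "complex_vector.span C = (UNIV :: 'e set)"
    and T: "complex_linear T"
    and U: "complex_vector.subspace U" "\<And>x. x \<in> U \<Longrightarrow> T x \<in> U" "U \<noteq> {0}"
  obtains c w where "w \<in> U" "w \<noteq> 0" "T w = c *\<^sub>C w"
proof -
  obtain u where u: "u \<in> U" "u \<noteq> 0"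
    using U(1,3) complex_vector.subspace_0 by blast
  obtain c where c: "\<exists>i\<le>card C. c i \<noteq> 0" "(\<Sum>i\<le>card C. c i *\<^sub>C (T ^^ i) u) = 0"
    using linear_relation_of_long_sequence[OF fin] .
  define p where "p = (\<Sum>i\<le>card C. monom (c i) i)"
  have coeff: "coeff p k = (if k \<le> card C then c k else 0)" for k
    by (simp add: p_def coeff_sum)
  then have "degree p \<le> card C"
    by (intro degree_le) auto
  then have "poly_apply T p u = 0"
    using c(2) by (simp add: poly_apply_superset coeff)
  moreover have "p \<noteq> 0"
    using c(1) coeff by (metis coeff_0)
  ultimately show ?thesis
    using eigenvector_of_annihilating_poly[OF T U(1,2), of p u] u that by auto
qed

section \<open>Multiplicities and commutants\<close>

lemma subspace_finite_span:
  assumes "finite C" "complex_vector.subspace U" "U \<subseteq> complex_vector.span C"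
  obtains D where "finite D" "complex_vector.independent D" "U = complex_vector.span D"
proof -
  obtain D where D: "D \<subseteq> U" "complex_vector.independent D" "U \<subseteq> complex_vector.span D"
    using complex_vector.maximal_independent_subset by blast
  have "finite D"
    using complex_vector.independent_span_bound[OF assms(1) D(2)] D(1) assms(3) by blast
  moreover have "U = complex_vector.span D"
    using D assms(2) by (metis complex_vector.span_minimal subset_antisym)
  ultimately show ?thesis using that D(2) by blast
qed

text \<open>
  The finite spanning set is essential, as \<open>dim\<close> is also 0 on spaces of infinite dimension.
\<close>

lemma proportional_if_dim_le_1:
  assumes "finite F" "H \<subseteq> complex_vector.span F" "complex_vector.dim H \<le> 1"
    and "j \<in> H" "s \<in> H" "j \<noteq> 0"
  obtains c where "s = c *\<^sub>C j"
proof (cases "s \<in> complex_vector.span {j}")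
  case True
  then show ?thesis using that by (auto simp: complex_vector.span_singleton)
next
  case False
  have ind: "complex_vector.independent {s, j}"
    using False assms(6) by (simp add: complex_vector.independent_insert)
  obtain D where D: "D \<subseteq> H" "complex_vector.independent D" "H \<subseteq> complex_vector.span D"
    "card D = complex_vector.dim H"
    using complex_vector.basis_exists by blast
  have "finite D"
    using complex_vector.independent_span_bound[OF assms(1) D(2)] D(1) assms(2) by blast
  then have "card {s, j} \<le> card D"
    using complex_vector.independent_span_bound[OF _ ind] D(3) assms(4,5) by blast
  moreover have "s \<noteq> j"
    using False by (auto simp: complex_vector.span_base)
  ultimately show ?thesis using D(4) assms(3) by simp
qed

lemma regular_representationD:
  assumes "regular_representation G W \<sigma>"
  shows "\<exists>B. finite B \<and> W = complex_vector.span B"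
    and "complex_vector.subspace W"
    and "g \<in> G \<Longrightarrow> x \<in> W \<Longrightarrow> \<sigma> g x \<in> W"
    and "g \<in> G \<Longrightarrow> x \<in> W \<Longrightarrow> y \<in> W \<Longrightarrow> \<sigma> g (x + y) = \<sigma> g x + \<sigma> g y"
    and "g \<in> G \<Longrightarrow> x \<in> W \<Longrightarrow> \<sigma> g (c *\<^sub>C x) = c *\<^sub>C \<sigma> g x"
  using assms by (auto simp: regular_representation_def complex_vector.subspace_span)

text \<open>
  The Hom space lies in the span of the matrix units for a basis \<open>B\<close> of \<open>W\<close> and the spanning set \<open>C\<close>.
\<close>

lemma Hom_G_finite_dimensional:
  fixes \<tau> :: "complex^'n^'n \<Rightarrow> 'e::complex_vector \<Rightarrow> 'e"
  assumes W: "regular_representation G W \<sigma>"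
    and C: "finite C" "complex_vector.span C = (UNIV :: 'e set)"
  obtains F where "finite F" "Hom_G G W \<sigma> \<tau> \<subseteq> complex_vector.span F"
proof -
  have sub: "complex_vector.subspace W"
    using regular_representationD(2)[OF W] .
  obtain B0 where B0: "finite B0" "W = complex_vector.span B0"
    using regular_representationD(1)[OF W] by blast
  obtain B where B: "finite B" "complex_vector.independent B" "W = complex_vector.span B"
    using subspace_finite_span[OF B0(1) sub] B0(2) by blast
  define h where "h b y = (\<lambda>x. if x \<in> W then complex_vector.representation B x b *\<^sub>C y else 0)"
    for b and y :: 'e
  define F where "F = (\<lambda>(b, e). h b e) ` (B \<times> C)"
  have h_span: "h b y \<in> complex_vector.span F" if "b \<in> B" for b y
  proof -
    have "y \<in> complex_vector.span C" using C(2) by simp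
    then show ?thesis
    proof (induction rule: complex_vector.span_induct_alt)
      case base
      have "h b 0 = 0" by (auto simp: h_def fun_eq_iff)
      then show ?case by (simp only: complex_vector.span_zero)
    next
      case (step c e y)
      have "h b (c *\<^sub>C e + y) = c *\<^sub>C h b e + h b y"
        by (auto simp: h_def fun_eq_iff scaleC_fun_def scaleC_add_right scaleC_scaleC mult.commute)
      moreover have "h b e \<in> complex_vector.span F"
        using that step by (auto simp: F_def intro: complex_vector.span_base)
      ultimately show ?case
        using step by (simp only: complex_vector.span_add complex_vector.span_scale)
    qed
  qed
  have "f \<in> complex_vector.span F" if f: "f \<in> Hom_G G W \<sigma> \<tau>" for f
  proof -
    have add: "f (x + y) = f x + f y" and sc: "f (c *\<^sub>C x) = c *\<^sub>C f x"
      if "x \<in> W" "y \<in> W" for x y c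
      using f that by (auto simp: Hom_G_def)
    have "f 0 = 0"
      using sc[of 0 0 0] complex_vector.subspace_0[OF sub] by simp
    have sum: "f (\<Sum>b\<in>A. c b *\<^sub>C b) = (\<Sum>b\<in>A. c b *\<^sub>C f b)" if "finite A" "A \<subseteq> W" for A c
      using that
    proof (induction A)
      case (insert a A)
      have "c a *\<^sub>C a \<in> W" "(\<Sum>b\<in>A. c b *\<^sub>C b) \<in> W"
        using insert.prems
        by (auto intro!: complex_vector.subspace_sum[OF sub] complex_vector.subspace_scale[OF sub])
      then show ?case using insert by (simp add: add sc)
    qed (simp add: \<open>f 0 = 0\<close>)
    have "B \<subseteq> W" using B(3) by (simp add: complex_vector.span_superset)
    have "f x = (\<Sum>b\<in>B. h b (f b)) x" for x
    proof -
      have app: "(\<Sum>b\<in>A. h b (f b)) x = (\<Sum>b\<in>A. h b (f b) x)" for A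
        by (induction A rule: infinite_finite_induct) simp_all
      show ?thesis
      proof (cases "x \<in> W")
        case True
        have "f x = f (\<Sum>b\<in>B. complex_vector.representation B x b *\<^sub>C b)"
          using complex_vector.sum_representation_eq[OF B(2), of x B] True B by simp
        also have "\<dots> = (\<Sum>b\<in>B. complex_vector.representation B x b *\<^sub>C f b)"
          by (rule sum[OF B(1) \<open>B \<subseteq> W\<close>])
        also have "\<dots> = (\<Sum>b\<in>B. h b (f b) x)"
          using True by (simp add: h_def)
        finally show ?thesis by (simp only: app)
      next
        case False
        then have "f x = 0" "(\<Sum>b\<in>B. h b (f b) x) = 0"
          using f by (simp_all add: h_def Hom_G_def)
        then show ?thesis by (simp only: app)
      qed
    qed
    then have "f = (\<Sum>b\<in>B. h b (f b))" by blast
    moreover have "(\<Sum>b\<in>B. h b (f b)) \<in> complex_vector.span F"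
      by (intro complex_vector.span_sum h_span)
    ultimately show ?thesis by simp
  qed
  moreover have "finite F" using B(1) C(1) by (simp add: F_def)
  ultimately show ?thesis using that by blast
qed

text \<open>
  A nonzero invariant subspace of minimal dimension is irreducible.
\<close>

lemma irreducible_subspace_exists:
  fixes \<tau> :: "complex^'n^'n \<Rightarrow> 'e::complex_vector \<Rightarrow> 'e"
  assumes C: "finite C" "complex_vector.span C = (UNIV :: 'e set)"
    and U: "invariant_subspace G \<tau> U" "U \<noteq> {0}"
  obtains W where "W \<subseteq> U" "invariant_subspace G \<tau> W" "W \<noteq> {0}"
    "\<And>X. X \<subseteq> W \<Longrightarrow> invariant_subspace G \<tau> X \<Longrightarrow> X = {0} \<or> X = W"
proof -
  obtain B where B: "finite B" "complex_vector.independent B" "complex_vector.span B = (UNIV :: 'e set)"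
    using finite_basis_UNIV[OF C] .
  interpret fd: finite_dimensional_vector_space "scaleC :: complex \<Rightarrow> 'e \<Rightarrow> 'e" B
    by unfold_locales (use B in auto)
  define Q where "Q W \<longleftrightarrow> W \<subseteq> U \<and> invariant_subspace G \<tau> W \<and> W \<noteq> {0}" for W
  have "Q U" using U by (simp add: Q_def)
  then obtain W where W: "Q W" and min: "\<And>X. Q X \<Longrightarrow> complex_vector.dim W \<le> complex_vector.dim X"
    using ex_has_least_nat[of Q U complex_vector.dim] by blast
  show ?thesis
  proof (rule that[of W])
    fix X assume X: "X \<subseteq> W" "invariant_subspace G \<tau> X"
    show "X = {0} \<or> X = W"
    proof (rule disjCI)
      assume "X \<noteq> W"
      show "X = {0}"
      proof (rule ccontr)
        assume "X \<noteq> {0}"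
        then have "Q X" using X W by (auto simp: Q_def)
        then have "X = W"
          using min X W fd.subspace_dim_equal[of X W] by (auto simp: Q_def invariant_subspace_def)
        with \<open>X \<noteq> W\<close> show False ..
      qed
    qed
  qed (use W in \<open>auto simp: Q_def\<close>)
qed

text \<open>
  Reductivity and multiplicities are phrased in terms of representations on subspaces of
  \<open>nat \<Rightarrow> complex\<close>.  Coordinates carry other representations there.
\<close>

lemma coordinate_embedding:
  fixes C :: "'e::complex_vector set"
  assumes "finite C" "complex_vector.span C = UNIV"
  obtains \<iota> :: "'e \<Rightarrow> nat \<Rightarrow> complex" where "complex_linear \<iota>" "inj \<iota>"
proof -
  obtain B where B: "finite B" "complex_vector.independent B" "complex_vector.span B = (UNIV :: 'e set)"
    using finite_basis_UNIV[OF assms] .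
  obtain e where e: "bij_betw e {0..<card B} B"
    using ex_bij_betw_nat_finite[OF B(1)] by blast
  define \<iota> where "\<iota> x n = complex_vector.representation B x (e n)" for x n
  have lin: "complex_linear \<iota>"
    by (rule complex_linearI)
      (simp_all add: \<iota>_def fun_eq_iff scaleC_fun_def scaleC_complex_def
        complex_vector.representation_add complex_vector.representation_scale B)
  moreover have "inj \<iota>"
  proof (rule injI)
    fix x y assume eq: "\<iota> x = \<iota> y"
    have "complex_vector.representation B x b = complex_vector.representation B y b" if "b \<in> B" for b
    proof -
      obtain n where "b = e n" using e \<open>b \<in> B\<close> unfolding bij_betw_def by blast
      then show ?thesis using fun_cong[OF eq, of n] by (simp add: \<iota>_def)
    qed
    then have "(\<Sum>b\<in>B. complex_vector.representation B x b *\<^sub>C b)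
        = (\<Sum>b\<in>B. complex_vector.representation B y b *\<^sub>C b)"
      by (intro sum.cong) auto
    moreover have "(\<Sum>b\<in>B. complex_vector.representation B z b *\<^sub>C b) = z" for z
      using B by (intro complex_vector.sum_representation_eq) auto
    ultimately show "x = y" by (simp only:)
  qed
  ultimately show ?thesis using that by blast
qed

lemma transport_regular_representation:
  fixes \<tau> :: "complex^'n^'n \<Rightarrow> 'e::complex_vector \<Rightarrow> 'e" and \<iota> :: "'e \<Rightarrow> 'w::complex_vector"
  assumes \<tau>: "regular_representation G UNIV \<tau>" and U: "invariant_subspace G \<tau> U"
    and \<iota>: "complex_linear \<iota>" "inj \<iota>"
  shows "regular_representation G (\<iota> ` U) (\<lambda>g w. \<iota> (\<tau> g (inv \<iota> w)))"
proof -
  note lin = complex_linearD[OF \<iota>(1)]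
  obtain C where C: "finite C" "complex_vector.span C = (UNIV :: 'e set)"
    using \<tau> by (auto simp: regular_representation_def)
  have sub: "complex_vector.subspace U" and inv: "\<And>g x. g \<in> G \<Longrightarrow> x \<in> U \<Longrightarrow> \<tau> g x \<in> U"
    using U by (auto simp: invariant_subspace_def)
  obtain D where D: "finite D" "U = complex_vector.span D"
    using subspace_finite_span[OF C(1) sub] C(2) by blast
  have hom: "module_hom scaleC scaleC \<iota>"
    using \<iota>(1) by (simp add: Vector_Spaces.linear_def)
  have fin: "\<exists>B. finite B \<and> \<iota> ` U = complex_vector.span B"
    using D module_hom.span_image[OF hom, of D] by (metis finite_imageI)
  have [simp]: "inv \<iota> (\<iota> x) = x" for x
    by (rule inv_f_f[OF \<iota>(2)])
  have pull: "inv \<iota> (\<iota> x + \<iota> y) = x + y" "inv \<iota> (c *\<^sub>C \<iota> x) = c *\<^sub>C x" for x y c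
    by (simp_all add: lin(1,2)[symmetric])
  have "regular_on G (\<lambda>g. \<phi> (\<iota> (\<tau> g x)))" if "complex_linear \<phi>" for \<phi> x
  proof -
    have "complex_linear (\<lambda>x. \<phi> (\<iota> x))"
      by (rule complex_linearI) (simp_all add: lin complex_linearD[OF that])
    then show ?thesis
      using \<tau> unfolding regular_representation_def by blast
  qed
  then show ?thesis
    unfolding regular_representation_def
    using fin \<tau> by (auto simp: pull inv regular_representation_def lin)
qed

lemma completely_reducible_reductive:
  fixes \<tau> :: "complex^'n^'n \<Rightarrow> 'e::complex_vector \<Rightarrow> 'e"
  assumes G: "reductive_group G" and \<tau>: "regular_representation G UNIV \<tau>"
    and U: "invariant_subspace G \<tau> U"
  obtains U' where "invariant_subspace G \<tau> U'" "U \<inter> U' = {0}" "\<forall>x. \<exists>y\<in>U. x - y \<in> U'"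
proof -
  obtain C where C: "finite C" "complex_vector.span C = (UNIV :: 'e set)"
    using \<tau> by (auto simp: regular_representation_def)
  obtain \<iota> :: "'e \<Rightarrow> nat \<Rightarrow> complex" where \<iota>: "complex_linear \<iota>" "inj \<iota>"
    using coordinate_embedding[OF C] .
  note lin = complex_linearD[OF \<iota>(1)]
  have hom: "module_hom scaleC scaleC \<iota>"
    using \<iota>(1) by (simp add: Vector_Spaces.linear_def)
  have [simp]: "inv \<iota> (\<iota> x) = x" for x
    by (rule inv_f_f[OF \<iota>(2)])
  let ?\<sigma> = "\<lambda>g w. \<iota> (\<tau> g (inv \<iota> w))"
  have "invariant_subspace G \<tau> UNIV"
    by (simp add: invariant_subspace_def)
  then have "completely_reducible G (range \<iota>) ?\<sigma>"
    using transport_regular_representation[OF \<tau> _ \<iota>] G by (simp add: reductive_group_def)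
  moreover have "invariant_subspace G ?\<sigma> (\<iota> ` U)"
    using U module_hom.subspace_image[OF hom] by (auto simp: invariant_subspace_def)
  moreover have "\<iota> ` U \<subseteq> range \<iota>"
    by (rule image_mono) simp
  ultimately have "\<exists>X\<subseteq>range \<iota>. invariant_subspace G ?\<sigma> X \<and> \<iota> ` U \<inter> X = {0} \<and>
      {x + y | x y. x \<in> \<iota> ` U \<and> y \<in> X} = range \<iota>"
    unfolding completely_reducible_def by (elim allE[of _ "\<iota> ` U"]) (simp only: simp_thms)
  then obtain X where X: "X \<subseteq> range \<iota>" "invariant_subspace G ?\<sigma> X" "\<iota> ` U \<inter> X = {0}"
    "{x + y | x y. x \<in> \<iota> ` U \<and> y \<in> X} = range \<iota>"
    by (elim exE conjE) (rule that)
  show ?thesis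
  proof (rule that[of "\<iota> -` X"])
    show "invariant_subspace G \<tau> (\<iota> -` X)"
      using X(2) module_hom.subspace_vimage[OF hom, of X]
      by (fastforce simp: invariant_subspace_def)
    have "0 \<in> U" "0 \<in> X"
      using U X(2) by (simp_all add: invariant_subspace_def complex_vector.subspace_0)
    moreover have "x = 0" if "x \<in> U" "\<iota> x \<in> X" for x
    proof -
      have "\<iota> x \<in> \<iota> ` U \<inter> X" using that by blast
      with X(3) have "\<iota> x \<in> {0}" by (simp only:)
      then have "\<iota> x = \<iota> 0" by (simp add: lin(3))
      then show ?thesis using \<iota>(2) by (simp add: inj_eq)
    qed
    ultimately show "U \<inter> \<iota> -` X = {0}" by (auto simp: lin)
    show "\<forall>x. \<exists>y\<in>U. x - y \<in> \<iota> -` X"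
    proof
      fix x
      have "\<iota> x \<in> range \<iota>" by simp
      then have "\<iota> x \<in> {x + y | x y. x \<in> \<iota> ` U \<and> y \<in> X}" by (simp only: X(4))
      then obtain u y where "u \<in> U" "y \<in> X" "\<iota> x = \<iota> u + y" by blast
      then have "\<iota> (x - u) \<in> X" by (simp add: lin(4))
      with \<open>u \<in> U\<close> show "\<exists>y\<in>U. x - y \<in> \<iota> -` X" by blast
    qed
  qed
qed

lemma invariant_kernel:
  assumes "complex_vector.subspace W" "\<And>g x. g \<in> G \<Longrightarrow> x \<in> W \<Longrightarrow> \<sigma> g x \<in> W"
    and "f \<in> Hom_G G W \<sigma> \<tau>" "h \<in> Hom_G G W \<sigma> \<tau>" "\<And>g. g \<in> G \<Longrightarrow> complex_linear (\<tau> g)"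
  shows "invariant_subspace G \<sigma> {w \<in> W. h w = c *\<^sub>C f w}"
proof -
  have "0 \<in> W" using assms(1) by (rule complex_vector.subspace_0)
  then have "f 0 = 0" "h 0 = 0"
    using assms(3,4) complex_vector.scale_zero_left[of 0]
    by (auto simp: Hom_G_def dest!: spec[of _ 0])
  then show ?thesis
    using assms(1-4) complex_linearD[OF assms(5)]
    by (auto simp: invariant_subspace_def complex_vector.subspace_def Hom_G_def
        scaleC_add_right scaleC_scaleC mult.commute)
qed

text \<open>
  Both the inclusion of \<open>W\<close> and the restriction of \<open>S\<close> to \<open>W\<close> are equivariant maps, and these form
  a space of dimension at most 1.
\<close>

lemma scalar_on_irreducible_subspace:
  fixes \<tau> :: "complex^'n^'n \<Rightarrow> 'e::complex_vector \<Rightarrow> 'e"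
  assumes \<tau>: "regular_representation G UNIV \<tau>"
    and mf: "\<And>(X :: (nat \<Rightarrow> complex) set) \<sigma>. irreducible_representation G X \<sigma> \<Longrightarrow>
      complex_vector.dim (Hom_G G X \<sigma> \<tau>) \<le> 1"
    and W: "invariant_subspace G \<tau> W" "W \<noteq> {0}"
      "\<And>X. X \<subseteq> W \<Longrightarrow> invariant_subspace G \<tau> X \<Longrightarrow> X = {0} \<or> X = W"
    and S: "equivariant_endomorphism G \<tau> S"
  obtains c where "\<And>x. x \<in> W \<Longrightarrow> S x = c *\<^sub>C x"
proof -
  obtain C where C: "finite C" "complex_vector.span C = (UNIV :: 'e set)"
    using \<tau> by (auto simp: regular_representation_def)
  obtain \<iota> :: "'e \<Rightarrow> nat \<Rightarrow> complex" where \<iota>: "complex_linear \<iota>" "inj \<iota>"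
    using coordinate_embedding[OF C] .
  note lin = complex_linearD[OF \<iota>(1)]
  have hom: "module_hom scaleC scaleC \<iota>"
    using \<iota>(1) by (simp add: Vector_Spaces.linear_def)
  have inv_\<iota> [simp]: "inv \<iota> (\<iota> x) = x" for x
    by (rule inv_f_f[OF \<iota>(2)])
  have pull: "inv \<iota> (\<iota> x + \<iota> y) = x + y" "inv \<iota> (c *\<^sub>C \<iota> x) = c *\<^sub>C x" for x y c
    by (simp_all add: lin(1,2)[symmetric])
  let ?\<sigma> = "\<lambda>g w. \<iota> (\<tau> g (inv \<iota> w))"
  have reg: "regular_representation G (\<iota> ` W) ?\<sigma>"
    by (rule transport_regular_representation[OF \<tau> W(1) \<iota>])
  have "irreducible_representation G (\<iota> ` W) ?\<sigma>"
    unfolding irreducible_representation_def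
  proof (intro conjI allI impI)
    show "\<iota> ` W \<noteq> {0}"
    proof
      assume *: "\<iota> ` W = {0}"
      have "x = 0" if "x \<in> W" for x
      proof -
        have "\<iota> x = \<iota> 0" using * that lin(3) by auto
        then show ?thesis using \<iota>(2) by (simp add: inj_eq)
      qed
      then show False
        using W(1,2) by (auto simp: invariant_subspace_def dest: complex_vector.subspace_0)
    qed
    fix X assume X: "X \<subseteq> \<iota> ` W" "invariant_subspace G ?\<sigma> X"
    have "invariant_subspace G \<tau> (\<iota> -` X)"
      using X(2) module_hom.subspace_vimage[OF hom, of X]
      by (fastforce simp: invariant_subspace_def)
    moreover have "\<iota> -` X \<subseteq> W"
      using X(1) \<iota>(2) by (auto simp: inj_def)
    ultimately have "\<iota> -` X = {0} \<or> \<iota> -` X = W"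
      using W(3) by blast
    moreover have "X = \<iota> ` (\<iota> -` X)"
      using X(1) by auto
    ultimately show "X = {0} \<or> X = \<iota> ` W"
      by (metis image_empty image_insert lin(3))
  qed (rule reg)
  then have dim: "complex_vector.dim (Hom_G G (\<iota> ` W) ?\<sigma> \<tau>) \<le> 1"
    by (rule mf)
  obtain F where F: "finite F" "Hom_G G (\<iota> ` W) ?\<sigma> \<tau> \<subseteq> complex_vector.span F"
    using Hom_G_finite_dimensional[OF reg C] .
  define j where "j w = (if w \<in> \<iota> ` W then inv \<iota> w else 0)" for w
  define s where "s w = (if w \<in> \<iota> ` W then S (inv \<iota> w) else 0)" for w
  have SW: "complex_linear S" "\<And>g x. g \<in> G \<Longrightarrow> S (\<tau> g x) = \<tau> g (S x)"
    using S by (auto simp: equivariant_endomorphism_def)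
  have closed: "\<iota> x + \<iota> y \<in> \<iota> ` W" "c *\<^sub>C \<iota> x \<in> \<iota> ` W" "\<And>g. g \<in> G \<Longrightarrow> \<tau> g x \<in> W"
    if "x \<in> W" "y \<in> W" for x y c
    using W(1) that by (auto simp: lin(1,2)[symmetric] invariant_subspace_def
        complex_vector.subspace_add complex_vector.subspace_scale)
  have "j \<in> Hom_G G (\<iota> ` W) ?\<sigma> \<tau>" "s \<in> Hom_G G (\<iota> ` W) ?\<sigma> \<tau>"
    by (auto simp: Hom_G_def j_def s_def pull closed SW(2) complex_linearD[OF SW(1)])
  moreover have "j \<noteq> 0"
  proof
    assume "j = 0"
    have "x = 0" if "x \<in> W" for x
    proof -
      have "j (\<iota> x) = x" using that by (simp add: j_def)
      then show ?thesis using \<open>j = 0\<close> by simp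
    qed
    then show False
      using W(1,2) by (auto simp: invariant_subspace_def dest: complex_vector.subspace_0)
  qed
  ultimately obtain c where c: "s = c *\<^sub>C j"
    using proportional_if_dim_le_1[OF F dim] by blast
  have "S x = c *\<^sub>C x" if "x \<in> W" for x
    using fun_cong[OF c, of "\<iota> x"] that by (simp add: s_def j_def scaleC_fun_def)
  then show ?thesis using that by blast
qed

text \<open>
  \<open>S\<close> and \<open>T\<close> commute on every irreducible subspace because they are scalars there.  So the
  subspace on which they commute contains every irreducible subspace, and a complement is zero.
\<close>

lemma commutant_commutative_if_multiplicity_free:
  fixes \<tau> :: "complex^'n^'n \<Rightarrow> 'e::complex_vector \<Rightarrow> 'e"
  assumes G: "reductive_group G" and \<tau>: "regular_representation G UNIV \<tau>"
    and mf: "\<And>(X :: (nat \<Rightarrow> complex) set) \<sigma>. irreducible_representation G X \<sigma> \<Longrightarrow>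
      complex_vector.dim (Hom_G G X \<sigma> \<tau>) \<le> 1"
    and S: "equivariant_endomorphism G \<tau> S" and T: "equivariant_endomorphism G \<tau> T"
  shows "S \<circ> T = T \<circ> S"
proof -
  obtain C where C: "finite C" "complex_vector.span C = (UNIV :: 'e set)"
    using \<tau> by (auto simp: regular_representation_def)
  define K where "K = {x. S (T x) = T (S x)}"
  have lin: "complex_linear S" "complex_linear T"
    and eq: "\<And>g x. g \<in> G \<Longrightarrow> S (\<tau> g x) = \<tau> g (S x)" "\<And>g x. g \<in> G \<Longrightarrow> T (\<tau> g x) = \<tau> g (T x)"
    using S T by (auto simp: equivariant_endomorphism_def)
  have K: "invariant_subspace G \<tau> K"
    by (auto simp: K_def invariant_subspace_def complex_vector.subspace_def eq
        complex_linearD[OF lin(1)] complex_linearD[OF lin(2)])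
  obtain U where U: "invariant_subspace G \<tau> U" "K \<inter> U = {0}" "\<forall>x. \<exists>y\<in>K. x - y \<in> U"
    using completely_reducible_reductive[OF G \<tau> K] .
  have "U = {0}"
  proof (rule ccontr)
    assume "U \<noteq> {0}"
    then obtain W where W: "W \<subseteq> U" "invariant_subspace G \<tau> W" "W \<noteq> {0}"
      "\<And>X. X \<subseteq> W \<Longrightarrow> invariant_subspace G \<tau> X \<Longrightarrow> X = {0} \<or> X = W"
      using irreducible_subspace_exists[OF C U(1)] by metis
    obtain c where c: "\<And>x. x \<in> W \<Longrightarrow> S x = c *\<^sub>C x"
      using scalar_on_irreducible_subspace[OF \<tau> mf W(2-4) S] by blast
    obtain d where d: "\<And>x. x \<in> W \<Longrightarrow> T x = d *\<^sub>C x"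
      using scalar_on_irreducible_subspace[OF \<tau> mf W(2-4) T] by blast
    have "W \<subseteq> K"
      by (auto simp: K_def c d complex_linearD[OF lin(1)] complex_linearD[OF lin(2)]
          scaleC_scaleC mult.commute)
    then have "W \<subseteq> {0}" using W(1) U(2) by blast
    then show False
      using W(2,3) complex_vector.subspace_0 by (auto simp: invariant_subspace_def)
  qed
  then have "x \<in> K" for x
    using U(3) by auto
  then show ?thesis by (auto simp: K_def fun_eq_iff)
qed

text \<open>
  Since \<open>f\<close> is injective with an invariant complement of its image, it has an equivariant left
  inverse \<open>P\<close>.  The endomorphisms \<open>f P\<close> and \<open>h P\<close> commute, which on the image of \<open>f\<close> says
  \<open>h = f P h\<close>.  Therefore \<open>h P\<close> maps the image of \<open>f\<close> to itself and has an eigenvector \<open>f w\<close> there,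
  with eigenvalue \<open>c\<close> say.  Then \<open>h - c f\<close> vanishes at \<open>w \<noteq> 0\<close>, hence on all of \<open>W\<close>.
\<close>

lemma Hom_G_proportional_if_commutant_commutative:
  fixes \<tau> :: "complex^'n^'n \<Rightarrow> 'e::complex_vector \<Rightarrow> 'e"
  assumes G: "reductive_group G" and \<tau>: "regular_representation G UNIV \<tau>"
    and comm: "\<And>S T. equivariant_endomorphism G \<tau> S \<Longrightarrow> equivariant_endomorphism G \<tau> T \<Longrightarrow>
      S \<circ> T = T \<circ> S"
    and W: "irreducible_representation G W \<sigma>"
    and f: "f \<in> Hom_G G W \<sigma> \<tau>" "f \<noteq> 0" and h: "h \<in> Hom_G G W \<sigma> \<tau>"
  obtains c where "h = c *\<^sub>C f"
proof -
  obtain C where C: "finite C" "complex_vector.span C = (UNIV :: 'e set)"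
    using \<tau> by (auto simp: regular_representation_def)
  have reg: "regular_representation G W \<sigma>" and nz: "W \<noteq> {0}"
    and irr: "\<And>U. U \<subseteq> W \<Longrightarrow> invariant_subspace G \<sigma> U \<Longrightarrow> U = {0} \<or> U = W"
    using W by (auto simp: irreducible_representation_def)
  note reg = regular_representationD(2-)[OF reg]
  have \<tau>lin: "complex_linear (\<tau> g)" if "g \<in> G" for g
    using regular_representation_linear[OF \<tau> that] .
  note \<tau>simps = complex_linearD[OF \<tau>lin]
  have fsimps: "\<And>x y. x \<in> W \<Longrightarrow> y \<in> W \<Longrightarrow> f (x + y) = f x + f y" "\<And>c x. x \<in> W \<Longrightarrow> f (c *\<^sub>C x) = c *\<^sub>C f x"
    "\<And>g x. g \<in> G \<Longrightarrow> x \<in> W \<Longrightarrow> f (\<sigma> g x) = \<tau> g (f x)" "\<And>x. x \<notin> W \<Longrightarrow> f x = 0"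
    using f(1) by (auto simp: Hom_G_def)
  have hsimps: "\<And>x y. x \<in> W \<Longrightarrow> y \<in> W \<Longrightarrow> h (x + y) = h x + h y" "\<And>c x. x \<in> W \<Longrightarrow> h (c *\<^sub>C x) = c *\<^sub>C h x"
    "\<And>g x. g \<in> G \<Longrightarrow> x \<in> W \<Longrightarrow> h (\<sigma> g x) = \<tau> g (h x)" "\<And>x. x \<notin> W \<Longrightarrow> h x = 0"
    using h by (auto simp: Hom_G_def)
  have zero: "0 \<in> W" "f 0 = 0"
    using complex_vector.subspace_0[OF reg(1)] fsimps(2)[of 0 0] by auto
  have "(\<lambda>_. 0) \<in> Hom_G G W \<sigma> \<tau>"
    by (simp add: Hom_G_def \<tau>simps)
  then have "invariant_subspace G \<sigma> {w \<in> W. f w = 1 *\<^sub>C 0}"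
    using invariant_kernel[of W G \<sigma> "\<lambda>_. 0" \<tau> f 1] reg(1,2) f(1) \<tau>lin by simp
  then have "{w \<in> W. f w = 0} = {0} \<or> {w \<in> W. f w = 0} = W"
    by (intro irr) auto
  moreover have "{w \<in> W. f w = 0} \<noteq> W"
  proof
    assume *: "{w \<in> W. f w = 0} = W"
    have "f w = 0" for w
      using * fsimps(4)[of w] by blast
    then show False using f(2) by (simp add: fun_eq_iff)
  qed
  ultimately have ker: "w = 0" if "w \<in> W" "f w = 0" for w
    using that by blast
  have diff: "v - w \<in> W" "f (v - w) = f v - f w" if "v \<in> W" "w \<in> W" for v w
  proof -
    show *: "v - w \<in> W" using that complex_vector.subspace_diff[OF reg(1)] by blast
    have "f v = f ((v - w) + w)" by simp
    also have "\<dots> = f (v - w) + f w" by (rule fsimps(1)[OF * that(2)])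
    finally show "f (v - w) = f v - f w" by simp
  qed
  have inj: "v = w" if "v \<in> W" "w \<in> W" "f v = f w" for v w
    using ker[of "v - w"] diff that by simp
  have U: "invariant_subspace G \<tau> (f ` W)"
    unfolding invariant_subspace_def complex_vector.subspace_def
  proof (intro conjI ballI allI)
    show "0 \<in> f ` W" using zero by (metis imageI)
    show "x + y \<in> f ` W" if "x \<in> f ` W" "y \<in> f ` W" for x y
      using that fsimps(1) complex_vector.subspace_add[OF reg(1)] by (auto simp flip: fsimps(1))
    show "c *\<^sub>C x \<in> f ` W" if "x \<in> f ` W" for c x
      using that complex_vector.subspace_scale[OF reg(1)] by (auto simp flip: fsimps(2))
    show "\<tau> g x \<in> f ` W" if "g \<in> G" "x \<in> f ` W" for g x
      using that reg(2) by (auto simp flip: fsimps(3))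
  qed
  obtain U' where U': "invariant_subspace G \<tau> U'" "f ` W \<inter> U' = {0}" "\<forall>x. \<exists>y\<in>f ` W. x - y \<in> U'"
    using completely_reducible_reductive[OF G \<tau> U] .
  have sub': "complex_vector.subspace U'" and inv': "\<And>g x. g \<in> G \<Longrightarrow> x \<in> U' \<Longrightarrow> \<tau> g x \<in> U'"
    using U'(1) by (auto simp: invariant_subspace_def)
  \<comment> \<open>The projection along the complement, followed by the inverse of \<open>f\<close>.\<close>
  define P where "P x = (SOME w. w \<in> W \<and> x - f w \<in> U')" for x
  have P: "P x \<in> W" "x - f (P x) \<in> U'" for x
  proof -
    have "\<exists>w. w \<in> W \<and> x - f w \<in> U'" using U'(3) by blast
    then have "P x \<in> W \<and> x - f (P x) \<in> U'" unfolding P_def by (rule someI_ex)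
    then show "P x \<in> W" "x - f (P x) \<in> U'" by auto
  qed
  have P_eq: "P x = w" if "w \<in> W" "x - f w \<in> U'" for x w
  proof -
    have "(x - f w) - (x - f (P x)) \<in> U'"
      using complex_vector.subspace_diff[OF sub'] that P by blast
    then have "f (P x - w) \<in> U'"
      by (simp add: diff(2)[OF P(1) that(1)])
    moreover have "f (P x - w) \<in> f ` W"
      by (intro imageI diff(1) P(1) that(1))
    ultimately have "f (P x - w) = 0" using U'(2) by blast
    then show ?thesis using ker[OF diff(1)[OF P(1) that(1)]] by simp
  qed
  have Padd: "P (x + y) = P x + P y" for x y
  proof (rule P_eq)
    show "P x + P y \<in> W" using P(1) complex_vector.subspace_add[OF reg(1)] by blast
    have "(x - f (P x)) + (y - f (P y)) \<in> U'"
      using P(2) complex_vector.subspace_add[OF sub'] by blast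
    then show "x + y - f (P x + P y) \<in> U'" by (simp add: fsimps P(1) algebra_simps)
  qed
  have Pscale: "P (c *\<^sub>C x) = c *\<^sub>C P x" for c x
  proof (rule P_eq)
    show "c *\<^sub>C P x \<in> W" using P(1) complex_vector.subspace_scale[OF reg(1)] by blast
    show "c *\<^sub>C x - f (c *\<^sub>C P x) \<in> U'"
      using complex_vector.subspace_scale[OF sub' P(2), of c x]
      by (simp add: fsimps P(1) complex_vector.scale_right_diff_distrib)
  qed
  have Peq: "P (\<tau> g x) = \<sigma> g (P x)" if "g \<in> G" for g x
  proof (rule P_eq)
    show "\<sigma> g (P x) \<in> W" using P(1) reg(2) that by blast
    show "\<tau> g x - f (\<sigma> g (P x)) \<in> U'"
      using inv'[OF that P(2), of x] that by (simp add: fsimps P(1) \<tau>simps)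
  qed
  have Pf: "P (f w) = w" if "w \<in> W" for w
    using that complex_vector.subspace_0[OF sub'] by (intro P_eq) auto
  have T: "equivariant_endomorphism G \<tau> (\<lambda>x. f (P x))"
    by (simp add: equivariant_endomorphism_def complex_linear_iff Padd Pscale Peq fsimps P(1))
  have S: "equivariant_endomorphism G \<tau> (\<lambda>x. h (P x))"
    by (simp add: equivariant_endomorphism_def complex_linear_iff Padd Pscale Peq hsimps P(1))
  have hf: "h w = f (P (h w))" if "w \<in> W" for w
    using fun_cong[OF comm[OF S T], of "f w"] that by (simp add: Pf)
  have "f ` W \<noteq> {0}"
    using nz ker zero by blast
  moreover have "h (P x) \<in> f ` W" if "x \<in> f ` W" for x
    using hf[OF P(1)[of x]] P(1) by (metis imageI)
  moreover have "complex_linear (\<lambda>x. h (P x))" "complex_vector.subspace (f ` W)"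
    using S U by (auto simp: equivariant_endomorphism_def invariant_subspace_def)
  ultimately obtain c u where u: "u \<in> f ` W" "u \<noteq> 0" "h (P u) = c *\<^sub>C u"
    using eigenvector_exists[OF C, of "\<lambda>x. h (P x)" "f ` W"] by metis
  then obtain w where w: "w \<in> W" "u = f w" by blast
  then have w: "w \<in> W" "w \<noteq> 0" "h w = c *\<^sub>C f w"
    using u zero(2) by (auto simp: Pf)
  have "invariant_subspace G \<sigma> {w \<in> W. h w = c *\<^sub>C f w}"
    by (rule invariant_kernel[OF reg(1,2) f(1) h \<tau>lin])
  then have "{w \<in> W. h w = c *\<^sub>C f w} = W"
    using irr[of "{w \<in> W. h w = c *\<^sub>C f w}"] w by blast
  then have "h x = c *\<^sub>C f x" for x
    using fsimps(4)[of x] hsimps(4)[of x] by (cases "x \<in> W") auto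
  then have "h = c *\<^sub>C f" by (simp add: fun_eq_iff scaleC_fun_def)
  then show ?thesis using that by blast
qed

lemma multiplicity_free_iff_commutant_commutative:
  fixes \<tau> :: "complex^'n^'n \<Rightarrow> 'e::complex_vector \<Rightarrow> 'e"
  assumes G: "reductive_group G" and \<tau>: "regular_representation G UNIV \<tau>"
  shows "(\<forall>(W :: (nat \<Rightarrow> complex) set) \<sigma>. irreducible_representation G W \<sigma> \<longrightarrow>
      complex_vector.dim (Hom_G G W \<sigma> \<tau>) \<le> 1) \<longleftrightarrow>
    (\<forall>S T. equivariant_endomorphism G \<tau> S \<longrightarrow> equivariant_endomorphism G \<tau> T \<longrightarrow>
      S \<circ> T = T \<circ> S)"
proof (intro iffI allI impI)
  fix S T
  assume "\<forall>(W :: (nat \<Rightarrow> complex) set) \<sigma>. irreducible_representation G W \<sigma> \<longrightarrow>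
      complex_vector.dim (Hom_G G W \<sigma> \<tau>) \<le> 1"
    and "equivariant_endomorphism G \<tau> S" "equivariant_endomorphism G \<tau> T"
  then show "S \<circ> T = T \<circ> S"
    by (intro commutant_commutative_if_multiplicity_free[OF G \<tau>]) auto
next
  fix W :: "(nat \<Rightarrow> complex) set" and \<sigma>
  assume comm: "\<forall>S T. equivariant_endomorphism G \<tau> S \<longrightarrow> equivariant_endomorphism G \<tau> T \<longrightarrow>
      S \<circ> T = T \<circ> S"
    and W: "irreducible_representation G W \<sigma>"
  have "\<exists>f. Hom_G G W \<sigma> \<tau> \<subseteq> complex_vector.span {f}"
  proof (cases "\<exists>f\<in>Hom_G G W \<sigma> \<tau>. f \<noteq> 0")
    case True
    then obtain f where f: "f \<in> Hom_G G W \<sigma> \<tau>" "f \<noteq> 0" by blast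
    have "h \<in> complex_vector.span {f}" if h: "h \<in> Hom_G G W \<sigma> \<tau>" for h
    proof -
      obtain c where "h = c *\<^sub>C f"
        using Hom_G_proportional_if_commutant_commutative[OF G \<tau> _ W f h] comm by blast
      then show ?thesis by (simp add: complex_vector.span_base complex_vector.span_scale)
    qed
    then show ?thesis by blast
  next
    case False
    then have "Hom_G G W \<sigma> \<tau> \<subseteq> complex_vector.span {0}"
      by (auto simp: complex_vector.span_zero)
    then show ?thesis by blast
  qed
  then obtain f where "Hom_G G W \<sigma> \<tau> \<subseteq> complex_vector.span {f}" by blast
  then show "complex_vector.dim (Hom_G G W \<sigma> \<tau>) \<le> 1"
    using complex_vector.dim_le_card[of "Hom_G G W \<sigma> \<tau>" "{f}"] by simp
qed

theorem proposition3p2: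
  fixes G :: "(complex^'n^'n) set"
    and \<rho> :: "complex^'n^'n \<Rightarrow> 'v::complex_vector \<Rightarrow> 'v"
  assumes "reductive_group G"
    and "regular_representation G UNIV \<rho>"
  shows "skew_multiplicity_free G \<rho> \<longleftrightarrow>
    (\<forall>x\<in>clifford_invariants G \<rho>. \<forall>y\<in>clifford_invariants G \<rho>. x * y = y * x)"
proof -
  have alg: "linear_algebraic_group G"
    using assms(1) by (simp add: reductive_group_def)
  show ?thesis
    unfolding skew_multiplicity_free_def clifford_invariants_commute_iff[OF alg assms(2)]
    by (rule multiplicity_free_iff_commutant_commutative[OF assms(1)
          exterior_regular_representation[OF alg assms(2)]])
qed

end
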